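(* Let $\mathcal{H}_S$ be a two-dimensional complex Hilbert space (a qubit) and let $\Lambda=\{\Lambda_t\}_t$ be a dynamics on $\mathcal{H}_S$ (a time-parametrized family of completely positive trace-preserving linear maps on $\mathcal{L}(\mathcal{H}_S)$). Then $\Lambda$ is GTD-Markovian if and only if it is $2$-S-Markovian.
   Context: Setting. $\mathcal{L}(\mathcal{H}_S)$ is the space of linear operators on $\mathcal{H}_S$, and $\mathcal{P}_+(\mathcal{H}_S)$ is the set of density matrices on $\mathcal{H}_S$. A dynamics (dynamical map) is a family $\Lambda=\{\Lambda_t\}_{t\ge 0}$ of completely positive trace-preserving (CPTP) linear maps $\Lambda_t:\mathcal{L}(\mathcal{H}_S)\to\mathcal{L}(\mathcal{H}_S)$ indexed by time $t$ (not assumed invertible). $\|A\|_1=\mathrm{Tr}\sqrt{A^\dagger A}$. Ensembles. A system ensemble of size $n$ is a collection $\mathcal{E}_S=\{p_i;\rho_i\}_{i=1}^n$ with $p_i\ge 0$, $\sum_i p_i=1$, $\rho_i\in\mathcal{P}_+(\mathcal{H}_S)$. $\mathcal{F}_S^n$ is the set of all such ensembles of size $n$, and $\mathcal{F}_S=\bigcup_{n\ge1}\mathcal{F}_S^n$. Physicality quantifiers (PQ). A system PQ is a bounded nonnegative real function $\mathcal{I}_S:\mathcal{F}_S\to\mathbb{R}$ such that $\mathcal{I}_S\{p_i;T[\rho_i]\}\le\mathcal{I}_S\{p_i;\rho_i\}$ for every CPTP map $T$ on $\mathcal{L}(\mathcal{H}_S)$ and every ensemble. A PQ of the form $\mathcal{I}_S^n$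 is a system PQ that vanishes on every ensemble not in $\mathcal{F}_S^n$. The associated dynamic PQ is $\Phi_t^{\mathcal{I}_S}\{p_i;\rho_i\}:=\mathcal{I}_S\{p_i;\Lambda_t[\rho_i]\}$. Markovianity. $\Lambda$ is $2$-S-Markovian if for every PQ of the form $\mathcal{I}_S^2$ and every $\mathcal{E}_S\in\mathcal{F}_S^2$, $t\mapsto\Phi_t^{\mathcal{I}_S^2}(\mathcal{E}_S)$ is monotonically decreasing (i.e. non-increasing). GTD. The generalized trace-distance quantifier is the system PQ given by $\mathcal{I}_S^{GTD}\{p_1,p_2,\rho_1,\rho_2\}:=\|p_1\rho_1-p_2\rho_2\|_1$ on $\mathcal{F}_S^2$ and $0$ on ensembles not in $\mathcal{F}_S^2$. $\Lambda$ is GTD-Markovian if $\Phi_t^{\mathcal{I}_S^{GTD}}(\mathcal{E}_S)$ is non-increasing in $t$ for every $\mathcal{E}_S\in\mathcal{F}_S$; that is, $t\mapsto\|p_1\Lambda_t[\rho_1]-p_2\Lambda_t[\rho_2]\|_1$ is non-increasing for all probabilities $p_1+p_2=1$ and all $\rho_1,\rho_2\in\mathcal{P}_+(\mathcal{H}_S)$. *)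

theory Defs
  imports "HOL-Analysis.Analysis"
begin

text \<open>Operators on the Hilbert space \<open>\<complex>\<^sup>n\<close> are matrices over an index type of cardinality \<open>n\<close>.\<close>

type_synonym 'n operator = "complex ^ 'n ^ 'n"

definition op_scale :: "complex \<Rightarrow> 'n::finite operator \<Rightarrow> 'n operator" where
  "op_scale c A = (\<chi> i j. c * A $ i $ j)"

lemma vector_space_op_scale:
  "vector_space (op_scale :: complex \<Rightarrow> 'n::finite operator \<Rightarrow> 'n operator)"
  by unfold_locales (simp_all add: op_scale_def vec_eq_iff algebra_simps)

definition dagger :: "'n::finite operator \<Rightarrow> 'n operator" where
  "dagger A = (\<chi> i j. cnj (A $ j $ i))"

text \<open>The library's inner product on \<open>complex ^ 'n\<close> is the real one; this is the complex one,
  conjugate-linear in the first argument.\<close>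

definition cinner :: "complex ^ 'n::finite \<Rightarrow> complex ^ 'n \<Rightarrow> complex" where
  "cinner v w = (\<Sum>i\<in>UNIV. cnj (v $ i) * w $ i)"

definition positive_op :: "'n::finite operator \<Rightarrow> bool" where
  "positive_op A \<longleftrightarrow> (\<forall>v. cinner v (A *v v) \<in> \<real>\<^sub>\<ge>\<^sub>0)"

definition density_matrices :: "'n::finite operator set" where
  "density_matrices = {\<rho>. positive_op \<rho> \<and> trace \<rho> = 1}"

text \<open>Every positive operator has exactly one positive square root. The description is only
  applied to positive operators below.\<close>

definition op_sqrt :: "'n::finite operator \<Rightarrow> 'n operator" where
  "op_sqrt A = (THE B. positive_op B \<and> B ** B = A)"

text \<open>The trace of \<open>op_sqrt (dagger A ** A)\<close> is a nonnegative real; \<open>Re\<close> is only a type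
  conversion.\<close>

definition trace_norm :: "'n::finite operator \<Rightarrow> real" where
  "trace_norm A = Re (trace (op_sqrt (dagger A ** A)))"

text \<open>An operator on \<open>\<complex>\<^sup>k \<otimes> \<complex>\<^sup>n\<close> is a \<open>k \<times> k\<close> block matrix \<open>X\<close> of operators on \<open>\<complex>\<^sup>n\<close>, where
  \<open>X i j\<close> matters for \<open>i, j < k\<close> only, and a vector of that space is a family \<open>v\<close> of \<open>k\<close>
  vectors of \<open>\<complex>\<^sup>n\<close>. The map \<open>id\<^sub>k \<otimes> T\<close> applies \<open>T\<close> to every block.\<close>

definition block_positive :: "nat \<Rightarrow> (nat \<Rightarrow> nat \<Rightarrow> 'n::finite operator) \<Rightarrow> bool" where
  "block_positive k X \<longleftrightarrow>
     (\<forall>v :: nat \<Rightarrow> complex ^ 'n. (\<Sum>i<k. \<Sum>j<k. cinner (v i) (X i j *v v j)) \<in> \<real>\<^sub>\<ge>\<^sub>0)"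

definition completely_positive :: "('n::finite operator \<Rightarrow> 'n operator) \<Rightarrow> bool" where
  "completely_positive T \<longleftrightarrow>
     (\<forall>k X. block_positive k X \<longrightarrow> block_positive k (\<lambda>i j. T (X i j)))"

definition trace_preserving :: "('n::finite operator \<Rightarrow> 'n operator) \<Rightarrow> bool" where
  "trace_preserving T \<longleftrightarrow> (\<forall>A. trace (T A) = trace A)"

definition cptp :: "('n::finite operator \<Rightarrow> 'n operator) \<Rightarrow> bool" where
  "cptp T \<longleftrightarrow> Vector_Spaces.linear op_scale op_scale T \<and> completely_positive T
     \<and> trace_preserving T"

text \<open>Time is a real number; nothing is required of a dynamics at negative times, and none of the
  notions below looks at them.\<close>

definition dynamical_map :: "(real \<Rightarrow> 'n::finite operator \<Rightarrow> 'n operator) \<Rightarrow> bool" where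
  "dynamical_map \<Lambda> \<longleftrightarrow> (\<forall>t\<ge>0. cptp (\<Lambda> t))"

text \<open>The ensemble \<open>{p\<^sub>i; \<rho>\<^sub>i}\<close> is the list of the pairs \<open>(p\<^sub>i, \<rho>\<^sub>i)\<close>, in the order of
  the index \<open>i\<close> and with repetitions allowed.\<close>

type_synonym 'n ensemble = "(real \<times> 'n operator) list"

definition ensembles_of_size :: "nat \<Rightarrow> 'n::finite ensemble set" where
  "ensembles_of_size n =
     {E. length E = n \<and> (\<forall>(p, \<rho>) \<in> set E. 0 \<le> p \<and> \<rho> \<in> density_matrices)
       \<and> sum_list (map fst E) = 1}"

definition ensembles :: "'n::finite ensemble set" where
  "ensembles = (\<Union>n\<in>{1..}. ensembles_of_size n)"

definition map_ensemble ::
    "('n::finite operator \<Rightarrow> 'n operator) \<Rightarrow> 'n ensemble \<Rightarrow> 'n ensemble" where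
  "map_ensemble T E = map (\<lambda>(p, \<rho>). (p, T \<rho>)) E"

text \<open>Quantifiers are functions on \<open>ensembles\<close>; their values on other lists are irrelevant.\<close>

definition system_PQ :: "('n::finite ensemble \<Rightarrow> real) \<Rightarrow> bool" where
  "system_PQ I \<longleftrightarrow>
     bounded (I ` ensembles) \<and> (\<forall>E\<in>ensembles. 0 \<le> I E) \<and>
     (\<forall>T. cptp T \<longrightarrow> (\<forall>E\<in>ensembles. I (map_ensemble T E) \<le> I E))"

definition system_PQ_of_size :: "nat \<Rightarrow> ('n::finite ensemble \<Rightarrow> real) \<Rightarrow> bool" where
  "system_PQ_of_size n I \<longleftrightarrow>
     system_PQ I \<and> (\<forall>E \<in> ensembles - ensembles_of_size n. I E = 0)"

definition dynamic_PQ ::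
    "(real \<Rightarrow> 'n::finite operator \<Rightarrow> 'n operator) \<Rightarrow> ('n ensemble \<Rightarrow> real)
      \<Rightarrow> real \<Rightarrow> 'n ensemble \<Rightarrow> real" where
  "dynamic_PQ \<Lambda> I t E = I (map_ensemble (\<Lambda> t) E)"

definition S_Markovian ::
    "nat \<Rightarrow> (real \<Rightarrow> 'n::finite operator \<Rightarrow> 'n operator) \<Rightarrow> bool" where
  "S_Markovian n \<Lambda> \<longleftrightarrow>
     (\<forall>I. system_PQ_of_size n I \<longrightarrow>
       (\<forall>E\<in>ensembles_of_size n. antimono_on {0..} (\<lambda>t. dynamic_PQ \<Lambda> I t E)))"

fun GTD :: "'n::finite ensemble \<Rightarrow> real" where
  "GTD [(p\<^sub>1, \<rho>\<^sub>1), (p\<^sub>2, \<rho>\<^sub>2)] = trace_norm (p\<^sub>1 *\<^sub>R \<rho>\<^sub>1 - p\<^sub>2 *\<^sub>R \<rho>\<^sub>2)"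
| "GTD _ = 0"

definition GTD_Markovian ::
    "(real \<Rightarrow> 'n::finite operator \<Rightarrow> 'n operator) \<Rightarrow> bool" where
  "GTD_Markovian \<Lambda> \<longleftrightarrow>
     (\<forall>E\<in>ensembles. antimono_on {0..} (\<lambda>t. dynamic_PQ \<Lambda> GTD t E))"

end

theory Submission
  imports Defs
begin

text \<open>
  The substance is the Alberti--Uhlmann theorem for qubits: a channel maps \<open>\<rho>\<^sub>i\<close> to \<open>\<sigma>\<^sub>i\<close> for
  \<open>i = 1, 2\<close> as soon as \<open>\<parallel>\<alpha> \<sigma>\<^sub>1 - \<beta> \<sigma>\<^sub>2\<parallel>\<^sub>1 \<le> \<parallel>\<alpha> \<rho>\<^sub>1 - \<beta> \<rho>\<^sub>2\<parallel>\<^sub>1\<close> for all \<open>\<alpha>, \<beta> \<ge> 0\<close>. Applied to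
  \<open>\<rho>\<^sub>i\<close> at an earlier and \<open>\<sigma>\<^sub>i\<close> at a later time it turns GTD-Markovianity into the existence of a
  channel from the earlier ensemble to the later one. The converse is contractivity of the trace
  norm.

  The chord of the Bloch ball through \<open>\<rho>\<^sub>1\<close> and \<open>\<rho>\<^sub>2\<close> ends in two pure states \<open>f\<close>, \<open>g\<close>; extending
  \<open>\<sigma>\<^sub>1\<close>, \<open>\<sigma>\<^sub>2\<close> with the same affine coordinates gives two operators \<open>X\<close>, \<open>Y\<close>, which the hypothesis
  forces to be states and to satisfy the same hypothesis relative to \<open>f\<close>, \<open>g\<close>. A chord through
  \<open>X\<close> and \<open>Y\<close> gives explicit purifications; rotating one of them attains exactly the overlap
  of \<open>f\<close> and \<open>g\<close>, and equal Gram matrices yield an isometry, that is, a channel with two Kraus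
  operators.
\<close>

section \<open>Operators on a qubit\<close>

text \<open>Four real coordinates for a Hermitian matrix: operator identities become polynomial
  identities over the reals.\<close>

definition herm :: "real \<Rightarrow> real \<Rightarrow> real \<Rightarrow> real \<Rightarrow> 2 operator" where
  "herm a e x y = (\<chi> i j. if i = 1 then if j = 1 then of_real a else Complex x y
                           else if j = 1 then Complex x (- y) else of_real e)"

definition outer :: "complex ^ 'n::finite \<Rightarrow> 'n operator" where
  "outer v = (\<chi> i j. v $ i * cnj (v $ j))"

lemma one_neq_two_2 [simp]: "(1::2) \<noteq> 2" "(2::2) \<noteq> 1"
  by (metis exhaust_2 UNIV_2 zero_neq_one)+

lemma herm_nth [simp]:
  "herm a e x y $ 1 $ 1 = of_real a" "herm a e x y $ 2 $ 2 = of_real e"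
  "herm a e x y $ 1 $ 2 = Complex x y" "herm a e x y $ 2 $ 1 = Complex x (- y)"
  by (simp_all add: herm_def)

lemma dagger_nth [simp]: "dagger A $ i $ j = cnj (A $ j $ i)"
  by (simp add: dagger_def)

lemma outer_nth [simp]: "outer v $ i $ j = v $ i * cnj (v $ j)"
  by (simp add: outer_def)

lemma operator_2_eq_iff:
  fixes A B :: "2 operator"
  shows "A = B \<longleftrightarrow> A$1$1 = B$1$1 \<and> A$1$2 = B$1$2 \<and> A$2$1 = B$2$1 \<and> A$2$2 = B$2$2"
  by (auto simp: vec_eq_iff forall_2)

lemma trace_2: "trace (A :: 2 operator) = A$1$1 + A$2$2"
  by (simp add: trace_def sum_2)

lemma mult_2_nth: "((A :: 2 operator) ** B) $ i $ j = A$i$1 * B$1$j + A$i$2 * B$2$j"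
  by (simp add: matrix_matrix_mult_def sum_2)

lemma cinner_2: "cinner (v :: complex^2) w = cnj (v$1) * w$1 + cnj (v$2) * w$2"
  by (simp add: cinner_def sum_2)

lemma mult_vec_2_nth: "((A :: 2 operator) *v v) $ i = A$i$1 * v$1 + A$i$2 * v$2"
  by (simp add: matrix_vector_mult_def sum_2)

lemma hermitian_2E:
  fixes A :: "2 operator"
  assumes "dagger A = A"
  obtains a e x y where "A = herm a e x y"
proof -
  have h: "cnj (A$1$1) = A$1$1" "cnj (A$2$2) = A$2$2" "cnj (A$1$2) = A$2$1"
    using arg_cong[OF assms, of "\<lambda>B. B$1$1"] arg_cong[OF assms, of "\<lambda>B. B$2$2"]
      arg_cong[OF assms, of "\<lambda>B. B$2$1"] by simp_all
  have "A = herm (Re (A$1$1)) (Re (A$2$2)) (Re (A$1$2)) (Im (A$1$2))"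
    using h by (auto simp: operator_2_eq_iff complex_eq_iff)
  then show ?thesis using that by blast
qed

lemma dagger_herm [simp]: "dagger (herm a e x y) = herm a e x y"
  by (simp add: operator_2_eq_iff complex_eq_iff)

lemma trace_herm [simp]: "trace (herm a e x y) = of_real (a + e)"
  by (simp add: trace_2)

lemma det_herm [simp]: "det (herm a e x y) = of_real (a * e - x\<^sup>2 - y\<^sup>2)"
  by (simp add: det_2 complex_eq_iff power2_eq_square)

lemma herm_add [simp]:
  "herm a e x y + herm a' e' x' y' = herm (a + a') (e + e') (x + x') (y + y')"
  by (simp add: operator_2_eq_iff complex_eq_iff)

lemma herm_diff [simp]:
  "herm a e x y - herm a' e' x' y' = herm (a - a') (e - e') (x - x') (y - y')"
  by (simp add: operator_2_eq_iff complex_eq_iff)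

lemma herm_scaleR [simp]: "r *\<^sub>R herm a e x y = herm (r * a) (r * e) (r * x) (r * y)"
  unfolding operator_2_eq_iff vector_scaleR_component by (simp add: complex_eq_iff)

lemma herm_eq_iff [simp]:
  "herm a e x y = herm a' e' x' y' \<longleftrightarrow> a = a' \<and> e = e' \<and> x = x' \<and> y = y'"
  by (auto simp: operator_2_eq_iff complex_eq_iff)

lemma dagger_outer [simp]: "dagger (outer v) = outer v"
  by (simp add: vec_eq_iff mult.commute)

section \<open>Positivity in coordinates\<close>

lemma cinner_herm:
  "cinner v (herm a e x y *v v) = of_real (a * (cmod (v$1))\<^sup>2 + e * (cmod (v$2))\<^sup>2
     + 2 * Re (cnj (v$1) * Complex x y * v$2))"
  unfolding cmod_power2
  by (simp add: cinner_2 mult_vec_2_nth complex_eq_iff algebra_simps power2_eq_square)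

text \<open>Two real eigenvalues are nonnegative exactly when their sum and product are. The proof
  avoids eigenvalues: test vectors one way, completing the square the other.\<close>

lemma positive_op_herm:
  "positive_op (herm a e x y) \<longleftrightarrow> 0 \<le> a + e \<and> 0 \<le> a * e - x\<^sup>2 - y\<^sup>2"
proof
  assume "positive_op (herm a e x y)"
  then have p: "0 \<le> a * (cmod (v$1))\<^sup>2 + e * (cmod (v$2))\<^sup>2
     + 2 * Re (cnj (v$1) * Complex x y * v$2)" for v :: "complex^2"
    unfolding positive_op_def cinner_herm by (simp add: complex_nonneg_Reals_iff)
  have v: "0 \<le> a * (u1\<^sup>2 + u2\<^sup>2) + e * (w1\<^sup>2 + w2\<^sup>2)
      + 2 * (w1 * (u1 * x + u2 * y) - w2 * (u1 * y - u2 * x))" for u1 u2 w1 w2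
    using p[of "vector [Complex u1 u2, Complex w1 w2]"]
    by (simp add: cmod_power2 algebra_simps)
  have a: "0 \<le> a" using v[of 1 0 0 0] by simp
  have e: "0 \<le> e" using v[of 0 0 1 0] by simp
  \<comment> \<open>Up to sign the test vectors \<open>(x + iy, -a)\<close> and, next,
    \<open>(-e, x - iy)\<close> are columns of the adjugate; the form equals \<open>a\<close> resp.
    \<open>e\<close> times the determinant there. For \<open>a = e = 0\<close> both bounds are void,
    hence the third vector.\<close>
  have "0 \<le> a * (a * e - x\<^sup>2 - y\<^sup>2)"
    using v[of x y "-a" 0] by (simp add: algebra_simps power2_eq_square)
  moreover have "0 \<le> e * (a * e - x\<^sup>2 - y\<^sup>2)"
    using v[of "-e" 0 x "-y"] by (simp add: algebra_simps power2_eq_square)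
  moreover have "a = 0 \<Longrightarrow> e = 0 \<Longrightarrow> x\<^sup>2 + y\<^sup>2 \<le> 0"
    using v[of x y "-1" 0] by (simp add: algebra_simps power2_eq_square)
  ultimately have "0 \<le> a * e - x\<^sup>2 - y\<^sup>2"
    using a e by (cases "a = 0"; cases "e = 0") (auto simp: zero_le_mult_iff)
  with a e show "0 \<le> a + e \<and> 0 \<le> a * e - x\<^sup>2 - y\<^sup>2" by simp
next
  assume h: "0 \<le> a + e \<and> 0 \<le> a * e - x\<^sup>2 - y\<^sup>2"
  then have "0 \<le> a * e" by (smt (verit) zero_le_power2)
  with h have a: "0 \<le> a" and e: "0 \<le> e" by (auto simp: zero_le_mult_iff)
  have "0 \<le> a * (u1\<^sup>2 + u2\<^sup>2) + e * (w1\<^sup>2 + w2\<^sup>2)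
      + 2 * (w1 * (u1 * x + u2 * y) - w2 * (u1 * y - u2 * x))" (is "0 \<le> ?q") for u1 u2 w1 w2
  proof (cases "a = 0")
    case True
    then have "x\<^sup>2 + y\<^sup>2 \<le> 0" using h by simp
    then have "x = 0" "y = 0" by (simp_all add: sum_power2_le_zero_iff)
    then show ?thesis using True e by simp
  next
    case False
    \<comment> \<open>Completing the square, multiplied by \<open>a\<close> to avoid
      division.\<close>
    have "a * ?q = (a * u1 + x * w1 - y * w2)\<^sup>2 + (a * u2 + x * w2 + y * w1)\<^sup>2
        + (a * e - x\<^sup>2 - y\<^sup>2) * (w1\<^sup>2 + w2\<^sup>2)"
      by (simp add: algebra_simps power2_eq_square)
    also have "\<dots> \<ge> 0" using h by simp
    finally show ?thesis using a False by (simp add: zero_le_mult_iff)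
  qed
  from this[of "Re (v$1)" "Im (v$1)" "Re (v$2)" "Im (v$2)" for v :: "complex^2"]
  show "positive_op (herm a e x y)"
    unfolding positive_op_def cinner_herm
    by (simp add: complex_nonneg_Reals_iff cmod_power2 algebra_simps)
qed

text \<open>Polarization: real values of the form on four vectors determine all entries up to
  conjugation.\<close>

lemma positive_op_hermitian:
  fixes A :: "2 operator"
  assumes "positive_op A"
  shows "dagger A = A"
proof -
  have p: "Im (cinner v (A *v v)) = 0" for v
    using assms unfolding positive_op_def by (auto simp: complex_nonneg_Reals_iff)
  show ?thesis
    using p[of "vector [1, 0]"] p[of "vector [0, 1]"] p[of "vector [1, 1]"] p[of "vector [1, \<i>]"]
    by (auto simp: cinner_2 mult_vec_2_nth operator_2_eq_iff complex_eq_iff)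
qed

lemma positive_op_2:
  fixes A :: "2 operator"
  shows "positive_op A \<longleftrightarrow> dagger A = A \<and> 0 \<le> Re (trace A) \<and> 0 \<le> Re (det A)"
proof (cases "dagger A = A")
  case True
  then obtain a e x y where "A = herm a e x y" by (rule hermitian_2E)
  then show ?thesis by (simp add: positive_op_herm)
qed (use positive_op_hermitian in auto)

lemma positive_op_cases:
  fixes A :: "2 operator"
  assumes "positive_op A"
  obtains a e x y where "A = herm a e x y" "0 \<le> a + e" "0 \<le> a * e - x\<^sup>2 - y\<^sup>2"
  using hermitian_2E[OF positive_op_hermitian[OF assms]] assms by (metis positive_op_herm)

section \<open>Square roots and the trace norm\<close>

lemma herm_sq:
  "herm a e x y ** herm a e x y =
     herm (a\<^sup>2 + x\<^sup>2 + y\<^sup>2) (e\<^sup>2 + x\<^sup>2 + y\<^sup>2) (x * (a + e)) (y * (a + e))"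
  by (simp add: operator_2_eq_iff mult_2_nth complex_eq_iff power2_eq_square algebra_simps)

text \<open>By Cayley--Hamilton, \<open>B\<^sup>2\<close> determines \<open>B\<close> up to its trace and determinant, and
  \<open>B\<^sup>2\<close> determines these two when they are nonnegative.\<close>

lemma positive_op_sqrt_unique:
  fixes B C :: "2 operator"
  assumes "positive_op B" "positive_op C" "B ** B = C ** C"
  shows "B = C"
proof -
  obtain a e x y where B: "B = herm a e x y" "0 \<le> a + e" "0 \<le> a * e - x\<^sup>2 - y\<^sup>2"
    using assms(1) by (rule positive_op_cases)
  obtain a' e' x' y' where C: "C = herm a' e' x' y'" "0 \<le> a' + e'" "0 \<le> a' * e' - x'\<^sup>2 - y'\<^sup>2"
    using assms(2) by (rule positive_op_cases)
  have eq: "a\<^sup>2 + x\<^sup>2 + y\<^sup>2 = a'\<^sup>2 + x'\<^sup>2 + y'\<^sup>2" "e\<^sup>2 + x\<^sup>2 + y\<^sup>2 = e'\<^sup>2 + x'\<^sup>2 + y'\<^sup>2"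
    "x * (a + e) = x' * (a' + e')" "y * (a + e) = y' * (a' + e')"
    using assms(3) unfolding B(1) C(1) herm_sq by simp_all
  have "(det B)\<^sup>2 = (det C)\<^sup>2"
    using arg_cong[OF assms(3), of det] by (simp add: det_mul power2_eq_square)
  then have "(a * e - x\<^sup>2 - y\<^sup>2)\<^sup>2 = (a' * e' - x'\<^sup>2 - y'\<^sup>2)\<^sup>2"
    unfolding B(1) C(1) det_herm by (simp only: flip: of_real_power) (simp only: of_real_eq_iff)
  then have d: "a * e - x\<^sup>2 - y\<^sup>2 = a' * e' - x'\<^sup>2 - y'\<^sup>2"
    using B C by (simp only: power2_eq_iff_nonneg)
  \<comment> \<open>The squared trace of \<open>B\<close> is the trace of \<open>B ** B\<close> plus
    twice the determinant.\<close>
  then have "(a + e)\<^sup>2 = (a' + e')\<^sup>2"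
    using eq by (simp add: power2_sum)
  then have t: "a + e = a' + e'" using B C by simp
  show "B = C"
  proof (cases "a + e = 0")
    case True
    have z: "a\<^sup>2 + x\<^sup>2 + y\<^sup>2 \<le> 0" "a'\<^sup>2 + x'\<^sup>2 + y'\<^sup>2 \<le> 0"
    proof -
      have "e = - a" "e' = - a'" using True t by simp_all
      then show "a\<^sup>2 + x\<^sup>2 + y\<^sup>2 \<le> 0" "a'\<^sup>2 + x'\<^sup>2 + y'\<^sup>2 \<le> 0"
        using B(3) C(3) by (simp_all add: power2_eq_square)
    qed
    then have "a = 0" "x = 0" "y = 0" "a' = 0" "x' = 0" "y' = 0"
      by (smt (verit) zero_le_power2 zero_eq_power2)+
    then show ?thesis using True t B(1) C(1) by simp
  next
    case False
    \<comment> \<open>Cayley-Hamilton: trace times \<open>B\<close> is \<open>B ** B\<close> plus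
      the determinant; the trace can be cancelled.\<close>
    have "a * (a + e) = a' * (a' + e')"
      using eq(1) d by (simp add: algebra_simps power2_eq_square)
    then show ?thesis using eq(3,4) t False B(1) C(1) by auto
  qed
qed

lemma op_sqrt_eqI:
  fixes B :: "2 operator"
  assumes "positive_op B" "B ** B = A"
  shows "op_sqrt A = B"
  unfolding op_sqrt_def using assms positive_op_sqrt_unique by (intro the_equality) auto

text \<open>The two squares under the maximum are those of the sum and of the difference of the
  eigenvalues. The sum counts when the signs agree, the difference when they are opposite.\<close>

lemma trace_norm_herm:
  "trace_norm (herm a e x y) = sqrt (max ((a + e)\<^sup>2) ((a - e)\<^sup>2 + 4 * x\<^sup>2 + 4 * y\<^sup>2))"
proof -
  let ?H = "herm a e x y"
  define d where "d = a * e - x\<^sup>2 - y\<^sup>2"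
  have m: "(a - e)\<^sup>2 + 4 * x\<^sup>2 + 4 * y\<^sup>2 = (a + e)\<^sup>2 - 4 * d"
    by (simp add: d_def power2_eq_square algebra_simps)
  consider "d \<ge> 0" "a + e \<ge> 0" | "d \<ge> 0" "a + e < 0" | "d < 0" by linarith
  then show ?thesis
  proof cases
    case 1
    then have "op_sqrt (dagger ?H ** ?H) = ?H"
      by (intro op_sqrt_eqI) (simp_all add: positive_op_herm d_def)
    with 1 show ?thesis unfolding m by (simp add: trace_norm_def)
  next
    case 2
    then have "op_sqrt (dagger ?H ** ?H) = herm (-a) (-e) (-x) (-y)"
      by (intro op_sqrt_eqI) (simp_all add: positive_op_herm d_def herm_sq algebra_simps)
    with 2 show ?thesis unfolding m by (simp add: trace_norm_def)
  next
    case 3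
    define t where "t = sqrt ((a + e)\<^sup>2 - 4 * d)"
    have t: "t\<^sup>2 = (a + e)\<^sup>2 - 4 * d" "0 < t"
      using 3 zero_le_power2[of "a + e"] unfolding t_def by (smt (verit) real_sqrt_pow2 real_sqrt_gt_0_iff)+
    \<comment> \<open>The eigenvalues have opposite signs, so the absolute value of
      \<open>?H\<close> has trace \<open>t\<close> and determinant \<open>- d\<close>.
      Cayley-Hamilton then leaves \<open>(?H ** ?H - d) / t\<close> as the only candidate.\<close>
    define B where "B = herm ((a\<^sup>2 + x\<^sup>2 + y\<^sup>2 - d) / t) ((e\<^sup>2 + x\<^sup>2 + y\<^sup>2 - d) / t)
      (x * (a + e) / t) (y * (a + e) / t)"
    have sum: "(a\<^sup>2 + x\<^sup>2 + y\<^sup>2 - d) / t + (e\<^sup>2 + x\<^sup>2 + y\<^sup>2 - d) / t = t"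
    proof -
      have "(a\<^sup>2 + x\<^sup>2 + y\<^sup>2 - d) + (e\<^sup>2 + x\<^sup>2 + y\<^sup>2 - d) = t\<^sup>2"
        unfolding t(1) d_def by (simp add: algebra_simps power2_eq_square)
      then show ?thesis using t(2) by (simp add: power2_eq_square flip: add_divide_distrib)
    qed
    have scale: "p / t * (q / t) - (u / t)\<^sup>2 - (v / t)\<^sup>2 = (p * q - u\<^sup>2 - v\<^sup>2) / t\<^sup>2" for p q u v
      by (simp add: power_divide diff_divide_distrib flip: power2_eq_square)
    have "(a\<^sup>2 + x\<^sup>2 + y\<^sup>2 - d) / t * ((e\<^sup>2 + x\<^sup>2 + y\<^sup>2 - d) / t)
        - (x * (a + e) / t)\<^sup>2 - (y * (a + e) / t)\<^sup>2 =
        ((a\<^sup>2 + x\<^sup>2 + y\<^sup>2 - d) * (e\<^sup>2 + x\<^sup>2 + y\<^sup>2 - d) - (x * (a + e))\<^sup>2 - (y * (a + e))\<^sup>2) / t\<^sup>2"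
      by (rule scale)
    also have "(a\<^sup>2 + x\<^sup>2 + y\<^sup>2 - d) * (e\<^sup>2 + x\<^sup>2 + y\<^sup>2 - d) - (x * (a + e))\<^sup>2 - (y * (a + e))\<^sup>2
        = - d * ((a + e)\<^sup>2 - 4 * d)"
      unfolding d_def by algebra
    also have "\<dots> / t\<^sup>2 = - d"
      using t by (simp flip: t(1))
    finally have det: "(a\<^sup>2 + x\<^sup>2 + y\<^sup>2 - d) / t * ((e\<^sup>2 + x\<^sup>2 + y\<^sup>2 - d) / t)
        - (x * (a + e) / t)\<^sup>2 - (y * (a + e) / t)\<^sup>2 = - d" .
    have det': "(e\<^sup>2 + x\<^sup>2 + y\<^sup>2 - d) / t * ((a\<^sup>2 + x\<^sup>2 + y\<^sup>2 - d) / t)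
        - (x * (a + e) / t)\<^sup>2 - (y * (a + e) / t)\<^sup>2 = - d"
      using det by (subst mult.commute)
    have sq: "p\<^sup>2 + u\<^sup>2 + v\<^sup>2 = p * t + d" if "p + q = t" "p * q - u\<^sup>2 - v\<^sup>2 = - d" for p q u v
      using that by (simp add: algebra_simps power2_eq_square flip: that(1))
    have "B ** B = dagger ?H ** ?H"
      unfolding B_def dagger_herm herm_sq herm_eq_iff sum
    proof (intro conjI)
      show "((a\<^sup>2 + x\<^sup>2 + y\<^sup>2 - d) / t)\<^sup>2 + (x * (a + e) / t)\<^sup>2 + (y * (a + e) / t)\<^sup>2 = a\<^sup>2 + x\<^sup>2 + y\<^sup>2"
        using sq[OF sum det] t by simp
      show "((e\<^sup>2 + x\<^sup>2 + y\<^sup>2 - d) / t)\<^sup>2 + (x * (a + e) / t)\<^sup>2 + (y * (a + e) / t)\<^sup>2 = e\<^sup>2 + x\<^sup>2 + y\<^sup>2"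
        using sq[OF trans[OF add.commute sum] det'] t by simp
    qed (use t in simp_all)
    moreover have "positive_op B"
      unfolding B_def positive_op_herm sum det using t 3 by simp
    ultimately have "trace_norm ?H = Re (trace B)"
      by (simp add: trace_norm_def op_sqrt_eqI)
    also have "\<dots> = t" unfolding B_def trace_herm sum by simp
    finally show ?thesis unfolding m using 3 by (simp add: t_def)
  qed
qed

text \<open>The squared trace norm is the squared trace plus \<open>4 * max 0 (- det)\<close>. Every
  trace-norm hypothesis below is turned into a statement on determinants this way.\<close>

lemma trace_norm_le_iff:
  fixes A B :: "2 operator"
  assumes "dagger A = A" "dagger B = B" "trace A = trace B"
  shows "trace_norm A \<le> trace_norm B \<longleftrightarrow> - Re (det A) \<le> max 0 (- Re (det B))"
proof -
  obtain a e x y a' e' x' y' where AB: "A = herm a e x y" "B = herm a' e' x' y'"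
    using assms hermitian_2E by metis
  have t: "a + e = a' + e'" using assms(3) unfolding AB by (simp only: trace_herm of_real_eq_iff)
  have m: "(a - e)\<^sup>2 + 4 * x\<^sup>2 + 4 * y\<^sup>2 = (a + e)\<^sup>2 - 4 * (a * e - x\<^sup>2 - y\<^sup>2)" for a e x y :: real
    by (simp add: power2_eq_square algebra_simps)
  show ?thesis
    unfolding AB trace_norm_herm m t det_herm by auto
qed

section \<open>Channels\<close>

lemma matrix_add_rdistrib: "(A + B) ** C = A ** C + B ** C"
  for A B C :: "'n::finite operator"
  by (simp add: vec_eq_iff matrix_matrix_mult_def algebra_simps sum.distrib)

lemma dagger_mult: "dagger (A ** B) = dagger B ** dagger A"
  by (simp add: vec_eq_iff matrix_matrix_mult_def mult.commute)

lemma cinner_dagger: "cinner v (K *v w) = cinner (dagger K *v v) w"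
proof -
  have "cinner v (K *v w) = (\<Sum>i\<in>UNIV. \<Sum>j\<in>UNIV. cnj (v$i) * K$i$j * w$j)"
    by (simp add: cinner_def matrix_vector_mult_def sum_distrib_left mult.assoc)
  also have "\<dots> = (\<Sum>j\<in>UNIV. \<Sum>i\<in>UNIV. cnj (v$i) * K$i$j * w$j)"
    by (rule sum.swap)
  also have "\<dots> = cinner (dagger K *v v) w"
    by (simp add: cinner_def matrix_vector_mult_def sum_distrib_left mult_ac)
  finally show ?thesis .
qed

lemma cinner_add_right: "cinner v (w + w') = cinner v w + cinner v w'"
  by (simp add: cinner_def algebra_simps sum.distrib)

lemma positive_op_add:
  assumes "positive_op A" "positive_op B"
  shows "positive_op (A + B)"
  using assms unfolding positive_op_def
  by (auto simp: matrix_vector_mult_add_rdistrib cinner_add_right intro: nonneg_Reals_add_I)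

text \<open>\<open>K\<close> moves over to the vectors, so the block form of the image at
  \<open>v\<close> is the original one at the family \<open>dagger K *v v i\<close>.\<close>

lemma completely_positive_conj: "completely_positive (\<lambda>A. K ** A ** dagger K)"
proof -
  have "cinner v ((K ** A ** dagger K) *v w) = cinner (dagger K *v v) (A *v (dagger K *v w))"
    for v w A
    by (simp add: cinner_dagger flip: matrix_vector_mul_assoc)
  then show ?thesis
    unfolding completely_positive_def block_positive_def by simp
qed

lemma completely_positive_add:
  assumes "completely_positive S" "completely_positive T"
  shows "completely_positive (\<lambda>A. S A + T A)"
  using assms unfolding completely_positive_def block_positive_def
  by (simp add: matrix_vector_mult_add_rdistrib cinner_add_right sum.distrib nonneg_Reals_add_I)

lemma linear_conj: "Vector_Spaces.linear op_scale op_scale (\<lambda>A. K ** A ** dagger K)"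
proof -
  interpret vector_space op_scale by (rule vector_space_op_scale)
  interpret vector_space_pair op_scale op_scale ..
  show ?thesis
    by unfold_locales
      (simp_all add: matrix_add_ldistrib matrix_add_rdistrib,
       simp_all add: op_scale_def vec_eq_iff matrix_matrix_mult_def sum_distrib_left
         sum_distrib_right mult_ac)
qed

lemma cptp_kraus2:
  assumes "dagger K ** K + dagger L ** L = mat 1"
  shows "cptp (\<lambda>A. K ** A ** dagger K + L ** A ** dagger L)"
proof -
  interpret vector_space op_scale by (rule vector_space_op_scale)
  interpret vector_space_pair op_scale op_scale ..
  have "trace (K ** A ** dagger K + L ** A ** dagger L) = trace A" for A
  proof -
    have "trace (K ** A ** dagger K + L ** A ** dagger L)
        = trace ((dagger K ** K + dagger L ** L) ** A)"
      by (simp add: trace_add matrix_add_rdistrib trace_mul_sym[of _ "dagger _"] matrix_mul_assoc)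
    then show ?thesis by (simp add: assms)
  qed
  then show ?thesis
    unfolding cptp_def trace_preserving_def
    by (simp add: linear_compose_add linear_conj completely_positive_add completely_positive_conj)
qed

lemma conj_outer: "K ** outer v ** dagger K = outer (K *v v)"
  by (simp add: vec_eq_iff matrix_matrix_mult_def matrix_vector_mult_def sum_distrib_left
      sum_distrib_right mult_ac)

text \<open>Complete positivity with a single block.\<close>

lemma cptp_positive_op:
  assumes "cptp T" "positive_op A"
  shows "positive_op (T A)"
proof -
  have "block_positive 1 (\<lambda>_ _. A)"
    using assms(2) by (simp add: block_positive_def positive_op_def)
  then have "block_positive 1 (\<lambda>_ _. T A)"
    using assms(1) unfolding cptp_def completely_positive_def by blast
  then have "cinner (v 0) (T A *v v 0) \<in> \<real>\<^sub>\<ge>\<^sub>0" for v :: "nat \<Rightarrow> _"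
    by (simp add: block_positive_def)
  from this[of "\<lambda>_. v" for v] show ?thesis by (simp add: positive_op_def)
qed

lemma cptp_trace: "cptp T \<Longrightarrow> trace (T A) = trace A"
  by (simp add: cptp_def trace_preserving_def)

lemma cptp_density: "cptp T \<Longrightarrow> \<rho> \<in> density_matrices \<Longrightarrow> T \<rho> \<in> density_matrices"
  by (simp add: density_matrices_def cptp_positive_op cptp_trace)

lemma scaleR_eq_op_scale: "r *\<^sub>R A = op_scale (of_real r) A"
  unfolding vec_eq_iff vector_scaleR_component by (simp add: op_scale_def scaleR_conv_of_real)

lemma cptp_linear:
  assumes "cptp T"
  shows "T (A + B) = T A + T B" "T (A - B) = T A - T B" "T (r *\<^sub>R A) = r *\<^sub>R T A"
proof -
  interpret Vector_Spaces.linear op_scale op_scale T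
    using assms by (simp add: cptp_def)
  show "T (A + B) = T A + T B" "T (A - B) = T A - T B" "T (r *\<^sub>R A) = r *\<^sub>R T A"
    by (simp_all add: add diff scale scaleR_eq_op_scale)
qed

lemma ensembles_of_size_2E:
  assumes "E \<in> ensembles_of_size 2"
  obtains p \<rho> q \<sigma> where "E = [(p, \<rho>), (q, \<sigma>)]" "0 \<le> p" "0 \<le> q" "p + q = 1"
    "\<rho> \<in> density_matrices" "\<sigma> \<in> density_matrices"
proof -
  from assms have "length E = Suc (Suc 0)" by (simp add: ensembles_of_size_def numeral_2_eq_2)
  then obtain a b where "E = [a, b]" by (auto simp: length_Suc_conv)
  moreover obtain p \<rho> q \<sigma> where "a = (p, \<rho>)" "b = (q, \<sigma>)" by fastforce
  ultimately show ?thesis using assms that by (auto simp: ensembles_of_size_def)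
qed

lemma ensembles_of_size_2I:
  assumes "0 \<le> p" "0 \<le> q" "p + q = 1" "\<rho> \<in> density_matrices" "\<sigma> \<in> density_matrices"
  shows "[(p, \<rho>), (q, \<sigma>)] \<in> ensembles_of_size 2"
  using assms by (simp add: ensembles_of_size_def)

section \<open>The trace distance\<close>

text \<open>Adding the trace of \<open>Q\<close> times the identity to \<open>P - Q\<close> gives
  \<open>P\<close> plus the adjugate of \<open>Q\<close>, which is positive. Four times its
  determinant is the squared sum of both traces minus the squared eigenvalue gap of
  \<open>P - Q\<close>.\<close>

lemma trace_norm_diff_le:
  fixes P Q :: "2 operator"
  assumes "positive_op P" "positive_op Q"
  shows "trace_norm (P - Q) \<le> Re (trace P) + Re (trace Q)"
proof -
  obtain a e x y where P: "P = herm a e x y" "0 \<le> a + e" "0 \<le> a * e - x\<^sup>2 - y\<^sup>2"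
    using assms(1) by (rule positive_op_cases)
  obtain a' e' x' y' where Q: "Q = herm a' e' x' y'" "0 \<le> a' + e'" "0 \<le> a' * e' - x'\<^sup>2 - y'\<^sup>2"
    using assms(2) by (rule positive_op_cases)
  \<comment> \<open>The second summand is the adjugate of \<open>Q\<close>.\<close>
  have "positive_op (P + herm e' a' (- x') (- y'))"
    using Q by (intro positive_op_add assms) (simp add: positive_op_herm mult.commute add.commute)
  then have "0 \<le> (a + e') * (e + a') - (x - x')\<^sup>2 - (y - y')\<^sup>2"
    by (simp add: P(1) positive_op_herm)
  also have "4 * \<dots> = (a + e + (a' + e'))\<^sup>2
      - ((a - a' - (e - e'))\<^sup>2 + 4 * (x - x')\<^sup>2 + 4 * (y - y')\<^sup>2)"
    by (simp add: algebra_simps power2_eq_square)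
  finally have "(a - a' - (e - e'))\<^sup>2 + 4 * (x - x')\<^sup>2 + 4 * (y - y')\<^sup>2 \<le> (a + e + (a' + e'))\<^sup>2"
    by simp
  moreover have "(a - a' + (e - e'))\<^sup>2 \<le> (a + e + (a' + e'))\<^sup>2"
    using P(2) Q(2) by (intro abs_le_square_iff[THEN iffD1]) linarith
  ultimately have "sqrt (max ((a - a' + (e - e'))\<^sup>2) ((a - a' - (e - e'))\<^sup>2 + 4 * (x - x')\<^sup>2 + 4 * (y - y')\<^sup>2))
      \<le> a + e + (a' + e')"
    using P(2) Q(2) by (intro real_le_lsqrt) auto
  then show ?thesis
    by (simp add: P(1) Q(1) trace_norm_herm)
qed

lemma positive_op_scaleR:
  assumes "0 \<le> r" "positive_op A"
  shows "positive_op (r *\<^sub>R A)"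
proof -
  have "cinner v ((r *\<^sub>R A) *v v) = of_real r * cinner v (A *v v)" for v
    by (simp add: scaleR_eq_op_scale op_scale_def cinner_def matrix_vector_mult_def
        sum_distrib_left mult_ac)
  then show ?thesis
    using assms unfolding positive_op_def by (simp add: nonneg_Reals_mult_I)
qed

lemma jordan_decomposition:
  fixes A :: "2 operator"
  assumes "dagger A = A"
  obtains P Q where "positive_op P" "positive_op Q" "A = P - Q"
    "trace_norm A = Re (trace P) + Re (trace Q)"
proof -
  obtain a e x y where A: "A = herm a e x y" using assms by (rule hermitian_2E)
  define d where "d = a * e - x\<^sup>2 - y\<^sup>2"
  have m: "(a - e)\<^sup>2 + 4 * x\<^sup>2 + 4 * y\<^sup>2 = (a + e)\<^sup>2 - 4 * d"
    by (simp add: d_def power2_eq_square algebra_simps)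
  consider "d \<ge> 0" "a + e \<ge> 0" | "d \<ge> 0" "a + e < 0" | "d < 0" by linarith
  then show ?thesis
  proof cases
    case 1
    then show ?thesis
      using that[of A "herm 0 0 0 0"] m by (simp add: A positive_op_herm d_def trace_norm_herm)
  next
    case 2
    then show ?thesis
      using that[of "herm 0 0 0 0" "herm (-a) (-e) (-x) (-y)"] m
      by (simp add: A positive_op_herm d_def trace_norm_herm)
  next
    case 3
    define t where "t = sqrt ((a + e)\<^sup>2 - 4 * d)"
    have t: "t\<^sup>2 = (a + e)\<^sup>2 - 4 * d" "0 < t"
      using 3 zero_le_power2[of "a + e"] unfolding t_def by (smt (verit) real_sqrt_pow2 real_sqrt_gt_0_iff)+
    have "\<bar>a + e\<bar> \<le> \<bar>t\<bar>" using 3 t by (intro power2_le_iff_abs_le[THEN iffD1]) simp_all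
    then have u: "0 \<le> t + (a + e)" "0 \<le> t - (a + e)" using t by linarith+
    \<comment> \<open>Spectral projections: with eigenvalues \<open>l1 > 0 > l2\<close> and gap
      \<open>t\<close>, \<open>P\<close> is \<open>l1 / t\<close> times \<open>A - l2\<close>, and
      \<open>Q\<close> is \<open>- l2 / t\<close> times \<open>l1 - A\<close>.\<close>
    define P Q where "P = ((t + (a + e)) / (2 * t)) *\<^sub>R herm ((t - e + a) / 2) ((t - a + e) / 2) x y"
      and "Q = ((t - (a + e)) / (2 * t)) *\<^sub>R herm ((t + e - a) / 2) ((t + a - e) / 2) (-x) (-y)"
    have "(t - e + a) / 2 * ((t - a + e) / 2) - x\<^sup>2 - y\<^sup>2 = (t\<^sup>2 - ((a - e)\<^sup>2 + 4 * x\<^sup>2 + 4 * y\<^sup>2)) / 4"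
      by (simp add: field_simps power2_eq_square)
    also have "\<dots> = 0" by (simp add: t m)
    finally have "(t - e + a) / 2 * ((t - a + e) / 2) - x\<^sup>2 - y\<^sup>2 = 0" .
    then have "positive_op (herm ((t - e + a) / 2) ((t - a + e) / 2) x y)"
      "positive_op (herm ((t + e - a) / 2) ((t + a - e) / 2) (-x) (-y))"
      unfolding positive_op_herm using t by (simp_all add: field_simps)
    then have "positive_op P" "positive_op Q"
      unfolding P_def Q_def using t u by (auto intro!: positive_op_scaleR simp del: herm_scaleR)
    moreover have "A = P - Q"
      unfolding A P_def Q_def herm_scaleR herm_diff herm_eq_iff
      using t by (auto simp: field_simps)
    moreover have "trace_norm A = Re (trace P) + Re (trace Q)"
    proof -
      have "trace_norm A = t"
        unfolding A trace_norm_herm m using 3 by (simp add: t_def)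
      also have "t = Re (trace P) + Re (trace Q)"
        unfolding P_def Q_def herm_scaleR trace_herm using t by (simp add: field_simps)
      finally show ?thesis .
    qed
    ultimately show ?thesis by (rule that)
  qed
qed

text \<open>A channel keeps the Jordan parts positive and their traces fixed, so the triangle bound
  for the images gives the norm of \<open>A\<close> back.\<close>

lemma cptp_trace_norm_le:
  fixes A :: "2 operator"
  assumes "cptp T" "dagger A = A"
  shows "trace_norm (T A) \<le> trace_norm A"
proof -
  obtain P Q where PQ: "positive_op P" "positive_op Q" "A = P - Q"
    "trace_norm A = Re (trace P) + Re (trace Q)"
    using assms(2) by (rule jordan_decomposition)
  have "trace_norm (T P - T Q) \<le> Re (trace (T P)) + Re (trace (T Q))"
    by (intro trace_norm_diff_le cptp_positive_op[OF assms(1)] PQ(1,2))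
  then show ?thesis
    unfolding PQ(4) by (simp add: PQ(3) cptp_linear cptp_trace assms(1))
qed

section \<open>Pairs of qubit states as mixtures of two pure states\<close>

lemma trace_outer: "trace (outer v) = cinner v v"
  by (simp add: trace_def cinner_def mult.commute)

lemma cnj_cinner: "cnj (cinner v w) = cinner w v"
  by (simp add: cinner_def mult.commute)

text \<open>With \<open>f\<close>, \<open>g\<close> as columns of \<open>V\<close> the operator is
  \<open>V diag(r, s) dagger V\<close>, so the Gram determinant appears.\<close>

lemma det_outer_combination:
  fixes f g :: "complex ^ 2"
  shows "det (r *\<^sub>R outer f + s *\<^sub>R outer g)
    = of_real (r * s) * (cinner f f * cinner g g - cinner f g * cinner g f)"
  unfolding det_2 vector_add_component vector_scaleR_component
  by (simp add: cinner_2 scaleR_conv_of_real algebra_simps)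

lemma positive_op_rank_one:
  fixes A :: "2 operator"
  assumes "positive_op A" "det A = 0"
  obtains v where "A = outer v"
proof -
  obtain a e x y where A: "A = herm a e x y" and t: "0 \<le> a + e"
    using assms(1) by (rule positive_op_cases)
  have d: "a * e = x\<^sup>2 + y\<^sup>2"
    using assms(2) unfolding A det_herm of_real_eq_0_iff by simp
  then have "0 \<le> a * e" by simp
  with t have ae: "0 \<le> a" "0 \<le> e" by (auto simp: zero_le_mult_iff)
  show ?thesis
  proof (cases "a = 0")
    case True
    then have "x = 0" "y = 0" using d by (simp_all add: sum_power2_eq_zero_iff)
    then have "A = outer (vector [0, of_real (sqrt e)])"
      using True ae by (simp add: A operator_2_eq_iff complex_eq_iff)
    then show ?thesis by (rule that)
  next
    case False
    with ae have a: "0 < a" by simp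
    have "e = (x * x + y * y) / a" using d a by (simp add: field_simps power2_eq_square)
    \<comment> \<open>The first column divided by \<open>sqrt a\<close>.\<close>
    then have "A = outer (vector [of_real (sqrt a), Complex (x / sqrt a) (- y / sqrt a)])"
      using a by (simp add: A operator_2_eq_iff complex_eq_iff add_divide_distrib)
    then show ?thesis by (rule that)
  qed
qed

text \<open>The concave function \<open>c + b * t - k * t\<^sup>2\<close> is nonnegative at 0 and at
  1, so its roots enclose both points.\<close>

lemma quadratic_roots_outside:
  fixes k b c :: real
  assumes "0 < k" "0 \<le> c" "k \<le> b + c"
  obtains l u where "l \<le> 0" "1 \<le> u" "c + b * l = k * l\<^sup>2" "c + b * u = k * u\<^sup>2"
proof -
  define D where "D = b\<^sup>2 + 4 * k * c"
  have D: "\<bar>b\<bar> \<le> sqrt D" "\<bar>2 * k - b\<bar> \<le> sqrt D"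
  proof -
    have "b\<^sup>2 \<le> D" using assms by (simp add: D_def)
    then show "\<bar>b\<bar> \<le> sqrt D" by (rule real_le_rsqrt[of "\<bar>b\<bar>", simplified])
    have "k * k \<le> k * (b + c)" using assms by (intro mult_left_mono) auto
    then have "(2 * k - b)\<^sup>2 \<le> D" by (simp add: D_def power2_eq_square algebra_simps)
    then show "\<bar>2 * k - b\<bar> \<le> sqrt D" by (rule real_le_rsqrt[of "\<bar>2 * k - b\<bar>", simplified])
  qed
  have sq: "sqrt D * sqrt D = b\<^sup>2 + 4 * k * c"
    unfolding real_sqrt_mult_self using assms by (simp add: D_def)
  have root: "c + b * ((b + s) / (2 * k)) = k * ((b + s) / (2 * k))\<^sup>2" if "s * s = b\<^sup>2 + 4 * k * c" for s
  proof -
    have "k * ((b + s) / (2 * k))\<^sup>2 = (b + s)\<^sup>2 / (4 * k)"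
      using assms by (simp add: power2_eq_square field_simps)
    also have "(b + s)\<^sup>2 = 4 * k * c + 2 * b * (b + s)"
      using that by (simp add: power2_eq_square algebra_simps)
    also have "\<dots> / (4 * k) = c + b * ((b + s) / (2 * k))"
      using assms by (simp add: field_simps)
    finally show ?thesis by simp
  qed
  show ?thesis
  proof (rule that)
    show "(b + - sqrt D) / (2 * k) \<le> 0" "1 \<le> (b + sqrt D) / (2 * k)"
      using assms D by (simp_all add: field_simps)
    show "c + b * ((b + - sqrt D) / (2 * k)) = k * ((b + - sqrt D) / (2 * k))\<^sup>2"
      by (rule root) (simp only: minus_mult_minus sq)
    show "c + b * ((b + sqrt D) / (2 * k)) = k * ((b + sqrt D) / (2 * k))\<^sup>2"
      by (rule root[OF sq])
  qed
qed

lemma density_matrices_2E: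
  assumes "\<rho> \<in> density_matrices"
  obtains a x y where "\<rho> = herm a (1 - a) x y" "x\<^sup>2 + y\<^sup>2 \<le> a * (1 - a)"
proof -
  from assms have "positive_op \<rho>" and t: "trace \<rho> = 1" by (auto simp: density_matrices_def)
  then obtain a e x y where h: "\<rho> = herm a e x y" "0 \<le> a * e - x\<^sup>2 - y\<^sup>2"
    by (auto elim: positive_op_cases)
  moreover have "e = 1 - a" using t unfolding h trace_herm of_real_eq_1_iff by simp
  ultimately show ?thesis using that by simp
qed

text \<open>The line through the Bloch vectors of two states meets the Bloch sphere in two points.\<close>

lemma density_matrices_chord_distinct:
  fixes \<rho> \<sigma> :: "2 operator"
  assumes "\<rho> \<in> density_matrices" "\<sigma> \<in> density_matrices" "\<rho> \<noteq> \<sigma>"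
  obtains f g r s c where "r \<in> {0..1}" "s \<in> {0..1}" "cinner f f = 1" "cinner g g = 1"
    "cinner f g = of_real c" "0 \<le> c" "c < 1"
    "\<rho> = r *\<^sub>R outer f + (1 - r) *\<^sub>R outer g" "\<sigma> = s *\<^sub>R outer f + (1 - s) *\<^sub>R outer g"
proof -
  obtain a x y where \<rho>: "\<rho> = herm a (1 - a) x y" "x\<^sup>2 + y\<^sup>2 \<le> a * (1 - a)"
    using assms(1) by (rule density_matrices_2E)
  obtain a' x' y' where \<sigma>: "\<sigma> = herm a' (1 - a') x' y'" "x'\<^sup>2 + y'\<^sup>2 \<le> a' * (1 - a')"
    using assms(2) by (rule density_matrices_2E)
  \<comment> \<open>The line with \<open>H 0 = \<sigma>\<close> and \<open>H 1 = \<rho>\<close>. Its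
    determinant is a concave quadratic in \<open>t\<close>, nonnegative at both states; its roots
    are the pure states.\<close>
  define H where "H t = herm (a' + t * (a - a')) (1 - (a' + t * (a - a'))) (x' + t * (x - x'))
    (y' + t * (y - y'))" for t
  define k where "k = (a - a')\<^sup>2 + (x - x')\<^sup>2 + (y - y')\<^sup>2"
  define b where "b = (a - a') * (1 - 2 * a') - 2 * x' * (x - x') - 2 * y' * (y - y')"
  define d where "d = a' * (1 - a') - x'\<^sup>2 - y'\<^sup>2"
  have det: "det (H t) = of_real (d + b * t - k * t\<^sup>2)" for t
    unfolding H_def det_herm of_real_eq_iff
    by (simp add: k_def b_def d_def algebra_simps power2_eq_square)
  have k: "0 < k"
  proof -
    have "k \<noteq> 0" using assms(3) unfolding \<rho>(1) \<sigma>(1) k_def by (auto simp: add_nonneg_eq_0_iff)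
    then show ?thesis by (simp add: k_def less_le)
  qed
  have d: "0 \<le> d" using \<sigma>(2) by (simp add: d_def)
  have "d + b - k = a * (1 - a) - x\<^sup>2 - y\<^sup>2"
    by (simp add: k_def b_def d_def algebra_simps power2_eq_square)
  then have "k \<le> b + d" using \<rho>(2) by linarith
  with k d obtain l u where lu: "l \<le> 0" "1 \<le> u" "d + b * l = k * l\<^sup>2" "d + b * u = k * u\<^sup>2"
    by (rule quadratic_roots_outside)
  have pure: "\<exists>v. H t = outer v" if "d + b * t = k * t\<^sup>2" for t
  proof -
    have "det (H t) = 0" by (simp add: det that)
    moreover from this have "positive_op (H t)"
      by (simp add: positive_op_2) (simp add: H_def)
    ultimately show ?thesis by (metis positive_op_rank_one)
  qed
  from pure[OF lu(4)] obtain f where f: "H u = outer f" ..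
  from pure[OF lu(3)] obtain g where g: "H l = outer g" ..
  have unit: "cinner f f = 1" "cinner g g = 1"
    unfolding trace_outer[symmetric] f[symmetric] g[symmetric] by (simp_all add: H_def)
  define z where "z = cinner f g"
  \<comment> \<open>A phase on \<open>g\<close> makes the overlap real and nonnegative without
    changing \<open>outer g\<close>; for overlap zero any phase serves.\<close>
  define w where "w = (if z = 0 then 1 else cnj z / of_real (cmod z))"
  have w: "w * cnj w = 1" "w * z = of_real (cmod z)"
    by (auto simp: w_def complex_norm_square[symmetric] power2_eq_square mult.commute norm_divide)
  define g' where "g' = (\<chi> i. w * g $ i)"
  have og: "outer g' = outer g"
    using w(1) by (simp add: g'_def vec_eq_iff)
  have "cinner f g' = w * z"
    by (simp add: g'_def z_def cinner_def sum_distrib_left mult_ac)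
  then have fg': "cinner f g' = of_real (cmod z)" using w by simp
  have unit': "cinner g' g' = 1"
    using unit(2) unfolding trace_outer[symmetric] og .
  \<comment> \<open>Computing this determinant in two ways relates the chord length to the overlap,
    which is therefore below 1.\<close>
  have "H u - H l = herm ((u - l) * (a - a')) (- ((u - l) * (a - a'))) ((u - l) * (x - x')) ((u - l) * (y - y'))"
    by (simp add: H_def algebra_simps)
  then have "det (H u - H l) = of_real (- ((u - l)\<^sup>2 * k))"
    unfolding k_def by (simp only: det_herm of_real_eq_iff) (simp add: algebra_simps power2_eq_square)
  moreover have "det (H u - H l) = of_real (- (1 - (cmod z)\<^sup>2))"
    using det_outer_combination[of 1 f "-1" g'] unit unit' fg' cnj_cinner[of f g']
    by (simp add: f g og power2_eq_square)
  ultimately have "(u - l)\<^sup>2 * k = 1 - (cmod z)\<^sup>2"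
    by (simp only: of_real_eq_iff)
  moreover have "0 < (u - l)\<^sup>2 * k" using k lu by simp
  ultimately have "(cmod z)\<^sup>2 < 1\<^sup>2" by simp
  then have c: "cmod z < 1" by (rule power2_less_imp_less) simp
  have on_chord: "H t = ((t - l) / (u - l)) *\<^sub>R outer f + (1 - (t - l) / (u - l)) *\<^sub>R outer g'" for t
  proof -
    have affine: "H (r * u + (1 - r) * l) = r *\<^sub>R outer f + (1 - r) *\<^sub>R outer g'" for r
      unfolding og f[symmetric] g[symmetric] H_def herm_scaleR herm_add herm_eq_iff
      by (simp add: algebra_simps)
    define r where "r = (t - l) / (u - l)"
    have "r * (u - l) = t - l" using lu by (simp add: r_def)
    then have "r * u + (1 - r) * l = t" by (simp add: algebra_simps)
    with affine show ?thesis unfolding r_def by metis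
  qed
  have "\<rho> = H 1" "\<sigma> = H 0" by (simp_all add: H_def \<rho>(1) \<sigma>(1))
  with on_chord[of 1] on_chord[of 0]
  have "\<rho> = ((1 - l) / (u - l)) *\<^sub>R outer f + (1 - (1 - l) / (u - l)) *\<^sub>R outer g'"
    "\<sigma> = ((0 - l) / (u - l)) *\<^sub>R outer f + (1 - (0 - l) / (u - l)) *\<^sub>R outer g'"
    by simp_all
  moreover have "(1 - l) / (u - l) \<in> {0..1}" "(0 - l) / (u - l) \<in> {0..1}"
    using lu by (auto simp: field_simps)
  ultimately show ?thesis
    using that unit(1) unit' fg' c by (metis norm_ge_zero)
qed

lemma density_matrices_chord:
  fixes \<rho> \<sigma> :: "2 operator"
  assumes "\<rho> \<in> density_matrices" "\<sigma> \<in> density_matrices"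
  obtains f g r s c where "r \<in> {0..1}" "s \<in> {0..1}" "cinner f f = 1" "cinner g g = 1"
    "cinner f g = of_real c" "0 \<le> c" "c < 1"
    "\<rho> = r *\<^sub>R outer f + (1 - r) *\<^sub>R outer g" "\<sigma> = s *\<^sub>R outer f + (1 - s) *\<^sub>R outer g"
proof (cases "\<rho> = \<sigma>")
  case True
  \<comment> \<open>Equal states fix no line, so one is drawn to a different state; of two distinct
    states at least one differs from \<open>\<rho>\<close>. The same weight then serves
    both.\<close>
  have "herm 1 0 0 0 \<in> density_matrices" "herm 0 1 0 0 \<in> density_matrices"
    by (simp_all add: density_matrices_def positive_op_herm)
  moreover have "herm 1 0 0 0 \<noteq> herm 0 1 0 0" by simp
  ultimately obtain \<tau> where "\<tau> \<in> density_matrices" "\<rho> \<noteq> \<tau>" by metis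
  with assms(1) show ?thesis
    by (rule density_matrices_chord_distinct) (use that True in metis)
next
  case False
  with assms show ?thesis by (rule density_matrices_chord_distinct) (use that in metis)
qed

section \<open>Channels with prescribed values on two states\<close>

text \<open>The pairs \<open>(x1, x2)\<close> and \<open>(y1, y2)\<close> are vectors of the system
  with a two-dimensional environment. Their Gram matrix is that of \<open>f\<close>,
  \<open>g\<close>, so an isometry carries one pair to the other; its blocks \<open>K\<close>,
  \<open>L\<close> are the Kraus operators.\<close>

lemma channel_of_purifications:
  fixes f g x1 x2 y1 y2 :: "complex ^ 2"
  assumes "cinner f f = 1" "cinner g g = 1" "cinner f g = of_real c" "0 \<le> c" "c < 1"
    and "cinner x1 x1 + cinner x2 x2 = 1" "cinner y1 y1 + cinner y2 y2 = 1"
    and "cinner x1 y1 + cinner x2 y2 = of_real c"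
  obtains T where "cptp T" "T (outer f) = outer x1 + outer x2" "T (outer g) = outer y1 + outer y2"
proof -
  define cols :: "complex ^ 2 \<Rightarrow> complex ^ 2 \<Rightarrow> 2 operator"
    where "cols v w = (\<chi> i j. if j = 1 then v $ i else w $ i)" for v w
  have gram: "dagger (cols v w) ** cols v' w' = (\<chi> i j. cinner (if i = 1 then v else w) (if j = 1 then v' else w'))"
    for v w v' w'
    by (simp add: operator_2_eq_iff mult_2_nth cols_def cinner_2)
  have swap: "cinner g f = of_real c" "cinner y1 x1 + cinner y2 x2 = of_real c"
    using arg_cong[OF assms(3), of cnj] arg_cong[OF assms(8), of cnj] by (simp_all add: cnj_cinner)
  define V where "V = cols f g"
  have VV: "dagger V ** V = dagger (cols x1 y1) ** cols x1 y1 + dagger (cols x2 y2) ** cols x2 y2"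
    unfolding V_def gram using assms swap by (simp add: operator_2_eq_iff)
  \<comment> \<open>The condition \<open>c < 1\<close> makes \<open>f\<close>, \<open>g\<close> a
    basis, so \<open>K\<close> and \<open>L\<close> can be defined by their values on it.\<close>
  have "det (dagger V ** V) = of_real (1 - c\<^sup>2)"
    unfolding V_def gram using assms swap by (simp add: det_2 power2_eq_square)
  moreover have "c\<^sup>2 < 1\<^sup>2" using assms by (intro power_strict_mono) auto
  then have "1 - c\<^sup>2 \<noteq> 0" by simp
  ultimately have "det (dagger V ** V) \<noteq> 0" by (metis of_real_eq_0_iff)
  then have "invertible V" by (simp add: det_mul invertible_det_nz)
  then obtain V' where V': "V ** V' = mat 1" "V' ** V = mat 1" by (auto simp: invertible_def)
  define K where "K = cols x1 y1 ** V'"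
  define L where "L = cols x2 y2 ** V'"
  have "dagger K ** K + dagger L ** L = dagger V' ** (dagger V ** V) ** V'"
    unfolding VV K_def L_def dagger_mult
    by (simp add: matrix_add_ldistrib matrix_add_rdistrib matrix_mul_assoc)
  also have "\<dots> = dagger (V ** V') ** (V ** V')"
    by (simp add: dagger_mult matrix_mul_assoc)
  also have "\<dots> = mat 1"
    by (simp add: V') (simp add: vec_eq_iff mat_def)
  finally have T: "cptp (\<lambda>A. K ** A ** dagger K + L ** A ** dagger L)" by (rule cptp_kraus2)
  have axis: "cols v w *v axis 1 1 = v" "cols v w *v axis 2 1 = w" for v w
    by (simp_all add: vec_eq_iff forall_2 mult_vec_2_nth cols_def axis_def)
  have "V' *v (V *v e) = e" for e
    by (simp add: matrix_vector_mul_assoc V')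
  from this[of "axis 1 1"] this[of "axis 2 1"]
  have "V' *v f = axis 1 1" "V' *v g = axis 2 1"
    by (simp_all add: V_def axis)
  then have "K *v f = x1" "K *v g = y1" "L *v f = x2" "L *v g = y2"
    by (simp_all add: K_def L_def axis flip: matrix_vector_mul_assoc)
  with T that show ?thesis by (simp add: conj_outer)
qed

text \<open>Inner products of a plane vector with unit vectors take every value up to its length in
  modulus.\<close>

lemma rotation_with_value:
  fixes p q c :: real
  assumes "c\<^sup>2 \<le> p\<^sup>2 + q\<^sup>2"
  obtains C S where "C\<^sup>2 + S\<^sup>2 = 1" "C * p + S * q = c"
proof (cases "p = 0 \<and> q = 0")
  case True
  then show ?thesis using that[of 1 0] assms by simp
next
  case False
  define R where "R = p\<^sup>2 + q\<^sup>2"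
  have R: "0 < R" using False by (simp add: R_def sum_power2_gt_zero_iff)
  \<comment> \<open>\<open>(C, S)\<close> gets component \<open>c\<close> along
    \<open>(p, q)\<close> and \<open>w\<close> along \<open>(-q, p)\<close>, both divided by
    \<open>R\<close>.\<close>
  define w where "w = sqrt (R - c\<^sup>2)"
  have w: "w\<^sup>2 = R - c\<^sup>2" using assms by (simp add: w_def R_def)
  have "(c * p - w * q)\<^sup>2 + (c * q + w * p)\<^sup>2 = (c\<^sup>2 + w\<^sup>2) * R"
    unfolding R_def by algebra
  also have "\<dots> = R\<^sup>2" unfolding w by (simp add: power2_eq_square)
  finally have "((c * p - w * q) / R)\<^sup>2 + ((c * q + w * p) / R)\<^sup>2 = 1"
    using R by (simp add: power_divide flip: add_divide_distrib)
  moreover have "(c * p - w * q) * p + (c * q + w * p) * q = c * R"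
    unfolding R_def by algebra
  then have "(c * p - w * q) / R * p + (c * q + w * p) / R * q = c"
    using R by (simp flip: add_divide_distrib)
  ultimately show ?thesis by (rule that)
qed

text \<open>Choosing \<open>\<alpha> * u = \<beta> * w\<close> removes the square. If exactly one of
  \<open>u\<close>, \<open>w\<close> vanishes, this is reached only in the limit of a ratio tending
  to 0.\<close>

lemma le_of_quadratic_bound:
  fixes M D K u w :: real
  assumes "0 \<le> M" "0 \<le> u" "0 \<le> w"
    and bound: "\<And>\<alpha> \<beta>. 0 \<le> \<alpha> \<Longrightarrow> 0 \<le> \<beta> \<Longrightarrow> M * (\<alpha> * \<beta> * D - (\<alpha> * u - \<beta> * w)\<^sup>2) \<le> \<alpha> * \<beta> * K"
  shows "M * D \<le> K"
proof -
  have limit: "M * D \<le> K" if lim: "\<And>h. 0 < h \<Longrightarrow> h * (M * D) \<le> h * (K + h * (M * v\<^sup>2))" for v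
  proof (rule field_le_epsilon)
    fix e :: real assume e: "0 < e"
    define h where "h = e / (M * v\<^sup>2 + 1)"
    have M: "0 < M * v\<^sup>2 + 1" using assms by (simp add: add_nonneg_pos)
    have h: "0 < h" using e M by (simp add: h_def)
    have "M * D \<le> K + h * (M * v\<^sup>2)" using lim[OF h] h by (simp only: mult_le_cancel_left_pos)
    also have "h * (M * v\<^sup>2) \<le> h * (M * v\<^sup>2 + 1)" using h by simp
    also have "\<dots> = e" using M by (simp add: h_def)
    finally show "M * D \<le> K + e" by simp
  qed
  consider "0 < u" "0 < w" | "u = 0" "w = 0" | "0 < u" "w = 0" | "u = 0" "0 < w"
    using assms(2,3) by linarith
  then show ?thesis
  proof cases
    case 1
    have "M * (w * u * D - (w * u - u * w)\<^sup>2) \<le> w * u * K" using assms by (intro bound)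
    then have "(w * u) * (M * D) \<le> (w * u) * K" by (simp add: algebra_simps)
    then show ?thesis using 1 by simp
  next
    case 2
    then show ?thesis using bound[of 1 1] by simp
  next
    case 3
    show ?thesis
    proof (rule limit)
      show "h * (M * D) \<le> h * (K + h * (M * u\<^sup>2))" if "0 < h" for h
        using bound[of h 1] that 3 by (simp add: algebra_simps power2_eq_square)
    qed
  next
    case 4
    show ?thesis
    proof (rule limit)
      show "h * (M * D) \<le> h * (K + h * (M * w\<^sup>2))" if "0 < h" for h
        using bound[of 1 h] that 4 by (simp add: algebra_simps power2_eq_square)
    qed
  qed
qed

lemma dagger_diff [simp]: "dagger (A - B) = dagger A - dagger B"
  by (simp add: vec_eq_iff)

lemma trace_zero [simp]: "trace (0 :: 'n::finite operator) = 0"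
  by (simp add: trace_def)

lemma dagger_0 [simp]: "dagger 0 = 0"
  by (simp add: vec_eq_iff)

lemma dagger_scaleR [simp]: "dagger (r *\<^sub>R A) = r *\<^sub>R dagger A"
  unfolding vec_eq_iff vector_scaleR_component dagger_nth by simp

lemma trace_scaleR: "trace (r *\<^sub>R A) = of_real r * trace A" for A :: "'n::finite operator"
  by (simp add: scaleR_eq_op_scale op_scale_def trace_def sum_distrib_left)

lemma density_matrices_dagger: "\<rho> \<in> density_matrices \<Longrightarrow> dagger \<rho> = \<rho>" for \<rho> :: "2 operator"
  by (simp add: density_matrices_def positive_op_hermitian)

lemma density_matrices_trace: "\<rho> \<in> density_matrices \<Longrightarrow> trace \<rho> = 1"
  by (simp add: density_matrices_def)

lemma cinner_bilinear:
  "cinner (v + v') w = cinner v w + cinner v' w"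
  "cinner (r *\<^sub>R v) w = of_real r * cinner v w"
  "cinner v (r *\<^sub>R w) = of_real r * cinner v w"
  unfolding cinner_def vector_add_component vector_scaleR_component
  by (simp_all add: algebra_simps sum.distrib sum_distrib_left scaleR_conv_of_real)

text \<open>The rotation acts on the environment alone, so it leaves the purified state unchanged:
  the cross terms cancel.\<close>

lemma outer_rotate:
  assumes "C\<^sup>2 + S\<^sup>2 = 1"
  shows "outer ((C * b) *\<^sub>R v + (S * b') *\<^sub>R w) + outer ((- S * b) *\<^sub>R v + (C * b') *\<^sub>R w)
    = b\<^sup>2 *\<^sub>R outer v + b'\<^sup>2 *\<^sub>R outer w"
proof -
  have "outer ((C * b) *\<^sub>R v + (S * b') *\<^sub>R w) + outer ((- S * b) *\<^sub>R v + (C * b') *\<^sub>R w)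
    = ((C\<^sup>2 + S\<^sup>2) * b\<^sup>2) *\<^sub>R outer v + ((C\<^sup>2 + S\<^sup>2) * b'\<^sup>2) *\<^sub>R outer w"
    unfolding vec_eq_iff vector_add_component vector_scaleR_component outer_nth
    by (simp add: scaleR_conv_of_real algebra_simps power2_eq_square)
  then show ?thesis by (simp add: assms)
qed

text \<open>The hypothesis says that the fidelity of \<open>X\<close> and \<open>Y\<close> is at least \<open>c\<^sup>2\<close>, so \<open>X\<close> and \<open>Y\<close>
  have purifications with the same overlap \<open>c\<close> as the two source vectors.\<close>

lemma channel_from_pure_pair:
  fixes X Y :: "2 operator"
  assumes f: "cinner f f = 1" "cinner g g = 1" "cinner f g = of_real c" "0 \<le> c" "c < 1"
    and XY: "X \<in> density_matrices" "Y \<in> density_matrices"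
    and le: "\<And>\<alpha> \<beta>. 0 \<le> \<alpha> \<Longrightarrow> 0 \<le> \<beta> \<Longrightarrow>
      trace_norm (\<alpha> *\<^sub>R X - \<beta> *\<^sub>R Y) \<le> trace_norm (\<alpha> *\<^sub>R outer f - \<beta> *\<^sub>R outer g)"
  obtains T where "cptp T" "T (outer f) = X" "T (outer g) = Y"
proof -
  obtain f' g' r s d where r: "r \<in> {0..1}" "s \<in> {0..1}"
    and f': "cinner f' f' = 1" "cinner g' g' = 1" "cinner f' g' = of_real d" and d: "0 \<le> d" "d < 1"
    and X: "X = r *\<^sub>R outer f' + (1 - r) *\<^sub>R outer g'"
    and Y: "Y = s *\<^sub>R outer f' + (1 - s) *\<^sub>R outer g'"
    using XY by (rule density_matrices_chord)
  have swap: "cinner g f = of_real c" "cinner g' f' = of_real d"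
    using arg_cong[OF f(3), of cnj] arg_cong[OF f'(3), of cnj] by (simp_all add: cnj_cinner)
  \<comment> \<open>Amplitudes: \<open>(a f', a' g')\<close> purifies \<open>X\<close> and
    \<open>(b f', b' g')\<close> purifies \<open>Y\<close>.\<close>
  define a a' b b' where "a = sqrt r" "a' = sqrt (1 - r)" "b = sqrt s" "b' = sqrt (1 - s)"
  then have sq: "a\<^sup>2 = r" "a'\<^sup>2 = 1 - r" "b\<^sup>2 = s" "b'\<^sup>2 = 1 - s" and
    nonneg: "0 \<le> a" "0 \<le> a'" "0 \<le> b" "0 \<le> b'"
    using r by auto
  define \<delta> where "\<delta> = a * b' - a' * b"
  have d2: "0 \<le> 1 - d\<^sup>2" using d by (simp add: power_le_one)
  have c2: "0 \<le> 1 - c\<^sup>2" using f(4,5) by (simp add: power_le_one)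
  have "(1 - d\<^sup>2) * \<delta>\<^sup>2 \<le> 1 - c\<^sup>2"
  proof (rule le_of_quadratic_bound)
    fix \<alpha> \<beta> :: real assume \<alpha>\<beta>: "0 \<le> \<alpha>" "0 \<le> \<beta>"
    have comb: "\<alpha> *\<^sub>R X - \<beta> *\<^sub>R Y
        = (\<alpha> * r - \<beta> * s) *\<^sub>R outer f' + (\<alpha> * (1 - r) - \<beta> * (1 - s)) *\<^sub>R outer g'"
      unfolding X Y by (simp add: algebra_simps)
    have det: "Re (det (\<alpha> *\<^sub>R X - \<beta> *\<^sub>R Y))
        = (\<alpha> * r - \<beta> * s) * (\<alpha> * (1 - r) - \<beta> * (1 - s)) * (1 - d\<^sup>2)"
      unfolding comb det_outer_combination f' swap
      by (simp add: power2_eq_square flip: of_real_mult)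
    have det': "Re (det (\<alpha> *\<^sub>R outer f - \<beta> *\<^sub>R outer g)) = - (\<alpha> * \<beta> * (1 - c\<^sup>2))"
      using det_outer_combination[of \<alpha> f "- \<beta>" g] unfolding f swap
      by (simp add: power2_eq_square flip: of_real_mult)
    have "- Re (det (\<alpha> *\<^sub>R X - \<beta> *\<^sub>R Y)) \<le> max 0 (- Re (det (\<alpha> *\<^sub>R outer f - \<beta> *\<^sub>R outer g)))"
      by (rule trace_norm_le_iff[THEN iffD1])
        (use le[OF \<alpha>\<beta>] XY f in \<open>simp_all add: density_matrices_dagger trace_sub trace_scaleR
          trace_outer density_matrices_trace\<close>)
    also have "\<dots> = \<alpha> * \<beta> * (1 - c\<^sup>2)"
      unfolding det' using \<alpha>\<beta> c2 by simp
    finally have "- ((\<alpha> * a\<^sup>2 - \<beta> * b\<^sup>2) * (\<alpha> * a'\<^sup>2 - \<beta> * b'\<^sup>2) * (1 - d\<^sup>2)) \<le> \<alpha> * \<beta> * (1 - c\<^sup>2)"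
      unfolding det sq .
    \<comment> \<open>This brings the determinant condition into the form needed to optimise over
      \<open>\<alpha>\<close> and \<open>\<beta>\<close>.\<close>
    moreover have "(1 - d\<^sup>2) * (\<alpha> * \<beta> * \<delta>\<^sup>2 - (\<alpha> * (a * a') - \<beta> * (b * b'))\<^sup>2)
        = - ((\<alpha> * a\<^sup>2 - \<beta> * b\<^sup>2) * (\<alpha> * a'\<^sup>2 - \<beta> * b'\<^sup>2) * (1 - d\<^sup>2))"
      unfolding \<delta>_def by algebra
    ultimately show "(1 - d\<^sup>2) * (\<alpha> * \<beta> * \<delta>\<^sup>2 - (\<alpha> * (a * a') - \<beta> * (b * b'))\<^sup>2) \<le> \<alpha> * \<beta> * (1 - c\<^sup>2)"
      by simp
  qed (use d2 nonneg in simp_all)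
  \<comment> \<open>Lagrange's identity; both sums of squares on the right are 1.\<close>
  moreover have "(a * b + a' * b')\<^sup>2 + (d * \<delta>)\<^sup>2 = (a\<^sup>2 + a'\<^sup>2) * (b\<^sup>2 + b'\<^sup>2) - (1 - d\<^sup>2) * \<delta>\<^sup>2"
    unfolding \<delta>_def by algebra
  ultimately have "c\<^sup>2 \<le> (a * b + a' * b')\<^sup>2 + (d * \<delta>)\<^sup>2" by (simp add: sq)
  then obtain C S where CS: "C\<^sup>2 + S\<^sup>2 = 1" "C * (a * b + a' * b') + S * (d * \<delta>) = c"
    by (rule rotation_with_value)
  \<comment> \<open>Rotating the purification of \<open>Y\<close> changes its overlap with that of
    \<open>X\<close> from \<open>a * b + a' * b'\<close> to the combination in \<open>CS\<close>,
    which equals \<open>c\<close>.\<close>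
  define x1 x2 y1 y2 where "x1 = a *\<^sub>R f'" "x2 = a' *\<^sub>R g'"
    "y1 = (C * b) *\<^sub>R f' + (S * b') *\<^sub>R g'" "y2 = (- S * b) *\<^sub>R f' + (C * b') *\<^sub>R g'"
  note xy = this
  have ox: "outer x1 + outer x2 = X"
    using outer_rotate[of 1 0 a f' a' g'] by (simp add: xy X sq)
  have oy: "outer y1 + outer y2 = Y"
    using outer_rotate[OF CS(1), of b f' b' g'] by (simp add: xy Y sq)
  obtain T where "cptp T" "T (outer f) = outer x1 + outer x2" "T (outer g) = outer y1 + outer y2"
  proof (rule channel_of_purifications[OF f])
    show "cinner x1 x1 + cinner x2 x2 = 1"
      unfolding trace_outer[symmetric] trace_add[symmetric] ox using XY by (simp add: density_matrices_trace)
    show "cinner y1 y1 + cinner y2 y2 = 1"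
      unfolding trace_outer[symmetric] trace_add[symmetric] oy using XY by (simp add: density_matrices_trace)
    have "cinner x1 y1 + cinner x2 y2 = of_real (C * (a * b + a' * b') + S * (d * \<delta>))"
      unfolding xy cinner_bilinear cinner_add_right f' swap by (simp add: \<delta>_def algebra_simps)
    then show "cinner x1 y1 + cinner x2 y2 = of_real c" unfolding CS(2) .
  qed
  then show ?thesis using that ox oy by metis
qed

lemma alberti_uhlmann_mixtures:
  fixes \<sigma>1 \<sigma>2 :: "2 operator"
  assumes f: "cinner f f = 1" "cinner g g = 1" "cinner f g = of_real c" "0 \<le> c" "c < 1"
    and \<sigma>: "\<sigma>1 \<in> density_matrices" "\<sigma>2 \<in> density_matrices"
    and rs: "r \<in> {0..1}" "s \<in> {0..1}" "s < r"
    and \<rho>: "\<rho>1 = r *\<^sub>R outer f + (1 - r) *\<^sub>R outer g" "\<rho>2 = s *\<^sub>R outer f + (1 - s) *\<^sub>R outer g"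
    and le: "\<And>\<alpha> \<beta>. 0 \<le> \<alpha> \<Longrightarrow> 0 \<le> \<beta> \<Longrightarrow>
      trace_norm (\<alpha> *\<^sub>R \<sigma>1 - \<beta> *\<^sub>R \<sigma>2) \<le> trace_norm (\<alpha> *\<^sub>R \<rho>1 - \<beta> *\<^sub>R \<rho>2)"
  obtains T where "cptp T" "T \<rho>1 = \<sigma>1" "T \<rho>2 = \<sigma>2"
proof -
  define k where "k = 1 / (r - s)"
  have k: "k * (r - s) = 1" "0 < k" using rs by (simp_all add: k_def)
  define X where "X = k *\<^sub>R ((1 - s) *\<^sub>R \<sigma>1 - (1 - r) *\<^sub>R \<sigma>2)"
  define Y where "Y = k *\<^sub>R (r *\<^sub>R \<sigma>2 - s *\<^sub>R \<sigma>1)"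
  \<comment> \<open>For weights in the unit interval, nonnegative \<open>\<alpha>\<close>,
    \<open>\<beta>\<close> yield nonnegative coefficients of \<open>A\<close> and \<open>B\<close>,
    so the hypothesis passes from the mixtures to the end points.\<close>
  have comb: "\<alpha> *\<^sub>R (k *\<^sub>R ((1 - s) *\<^sub>R A - (1 - r) *\<^sub>R B)) - \<beta> *\<^sub>R (k *\<^sub>R (r *\<^sub>R B - s *\<^sub>R A))
      = (k * (\<alpha> * (1 - s) + \<beta> * s)) *\<^sub>R A - (k * (\<alpha> * (1 - r) + \<beta> * r)) *\<^sub>R B"
    for \<alpha> \<beta> and A B :: "2 operator"
    by (simp add: algebra_simps)
  have F: "outer f = k *\<^sub>R ((1 - s) *\<^sub>R \<rho>1 - (1 - r) *\<^sub>R \<rho>2)"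
  proof -
    have "k *\<^sub>R ((1 - s) *\<^sub>R \<rho>1 - (1 - r) *\<^sub>R \<rho>2) = (k * (r - s)) *\<^sub>R outer f"
      by (simp add: \<rho> algebra_simps)
    then show ?thesis by (simp add: k)
  qed
  have G: "outer g = k *\<^sub>R (r *\<^sub>R \<rho>2 - s *\<^sub>R \<rho>1)"
  proof -
    have "k *\<^sub>R (r *\<^sub>R \<rho>2 - s *\<^sub>R \<rho>1) = (k * (r - s)) *\<^sub>R outer g"
      by (simp add: \<rho> algebra_simps)
    then show ?thesis by (simp add: k)
  qed
  have le': "trace_norm (\<alpha> *\<^sub>R X - \<beta> *\<^sub>R Y) \<le> trace_norm (\<alpha> *\<^sub>R outer f - \<beta> *\<^sub>R outer g)"
    if "0 \<le> \<alpha>" "0 \<le> \<beta>" for \<alpha> \<beta>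
    unfolding F G X_def Y_def comb using that rs k by (intro le) simp_all
  have herm: "dagger X = X" "dagger Y = Y"
    using \<sigma> by (simp_all add: X_def Y_def density_matrices_dagger)
  have trace: "trace X = 1" "trace Y = 1"
    using \<sigma> k(1) unfolding X_def Y_def
    by (simp_all add: trace_scaleR trace_sub density_matrices_trace flip: of_real_mult of_real_diff)
  have det0: "det (outer v) = 0" for v :: "complex^2"
    by (simp add: det_2)
  have det_uminus: "det (- A) = det A" for A :: "2 operator"
    by (simp add: det_2)
  \<comment> \<open>The determinant of \<open>outer f\<close> is zero, so the comparison at
    \<open>\<alpha> = 1\<close>, \<open>\<beta> = 0\<close> says that \<open>X\<close> has
    nonnegative determinant.\<close>
  have X: "X \<in> density_matrices"
    using trace_norm_le_iff[of X "outer f"] le'[of 1 0] herm trace det0 f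
    by (simp add: density_matrices_def positive_op_2 trace_outer)
  have "trace_norm (- Y) \<le> trace_norm (- outer g)"
    using le'[of 0 1] by simp
  then have Y: "Y \<in> density_matrices"
    using trace_norm_le_iff[of "- Y" "- outer g"] herm trace det0 f
      trace_sub[of 0 Y] trace_sub[of 0 "outer g"]
      dagger_diff[of 0 Y] dagger_diff[of 0 "outer g"]
    by (simp add: density_matrices_def positive_op_2 trace_outer det_uminus)
  obtain T where T: "cptp T" "T (outer f) = X" "T (outer g) = Y"
    using f X Y le' by (rule channel_from_pure_pair)
  have "T \<rho>1 = r *\<^sub>R X + (1 - r) *\<^sub>R Y" "T \<rho>2 = s *\<^sub>R X + (1 - s) *\<^sub>R Y"
    by (simp_all add: \<rho> cptp_linear T)
  moreover have "r *\<^sub>R X + (1 - r) *\<^sub>R Y = (k * (r - s)) *\<^sub>R \<sigma>1"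
    by (simp add: X_def Y_def algebra_simps)
  moreover have "s *\<^sub>R X + (1 - s) *\<^sub>R Y = (k * (r - s)) *\<^sub>R \<sigma>2"
    by (simp add: X_def Y_def algebra_simps)
  ultimately show ?thesis using T(1) that by (simp add: k)
qed

theorem alberti_uhlmann:
  fixes \<rho>1 \<rho>2 \<sigma>1 \<sigma>2 :: "2 operator"
  assumes \<rho>: "\<rho>1 \<in> density_matrices" "\<rho>2 \<in> density_matrices"
    and \<sigma>: "\<sigma>1 \<in> density_matrices" "\<sigma>2 \<in> density_matrices"
    and le: "\<And>\<alpha> \<beta>. 0 \<le> \<alpha> \<Longrightarrow> 0 \<le> \<beta> \<Longrightarrow>
      trace_norm (\<alpha> *\<^sub>R \<sigma>1 - \<beta> *\<^sub>R \<sigma>2) \<le> trace_norm (\<alpha> *\<^sub>R \<rho>1 - \<beta> *\<^sub>R \<rho>2)"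
  obtains T where "cptp T" "T \<rho>1 = \<sigma>1" "T \<rho>2 = \<sigma>2"
proof -
  obtain f g r s c where rs: "r \<in> {0..1}" "s \<in> {0..1}"
    and f: "cinner f f = 1" "cinner g g = 1" "cinner f g = of_real c" and c: "0 \<le> c" "c < 1"
    and \<rho>_eq: "\<rho>1 = r *\<^sub>R outer f + (1 - r) *\<^sub>R outer g" "\<rho>2 = s *\<^sub>R outer f + (1 - s) *\<^sub>R outer g"
    using \<rho> by (rule density_matrices_chord)
  have swap: "cinner g f = of_real c"
    using arg_cong[OF f(3), of cnj] by (simp add: cnj_cinner)
  consider "s < r" | "r < s" | "r = s" by linarith
  then show ?thesis
  proof cases
    case 1
    show ?thesis
      by (rule alberti_uhlmann_mixtures[OF f c \<sigma> rs 1 \<rho>_eq le]) (use that in metis)+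
  next
    case 2
    \<comment> \<open>Exchanging \<open>f\<close> and \<open>g\<close> reverses the order of the
      weights.\<close>
    have "\<rho>1 = (1 - r) *\<^sub>R outer g + (1 - (1 - r)) *\<^sub>R outer f"
      "\<rho>2 = (1 - s) *\<^sub>R outer g + (1 - (1 - s)) *\<^sub>R outer f"
      by (simp_all add: \<rho>_eq)
    from alberti_uhlmann_mixtures[OF f(2,1) swap c \<sigma> _ _ _ this le] 2 rs that show ?thesis
      by auto
  next
    case 3
    have "trace_norm (\<sigma>1 - \<sigma>2) \<le> trace_norm (0 :: 2 operator)"
      using le[of 1 1] 3 by (simp add: \<rho>_eq)
    then have det: "- Re (det (\<sigma>1 - \<sigma>2)) \<le> 0"
      using \<sigma> trace_norm_le_iff[of "\<sigma>1 - \<sigma>2" 0]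
      by (simp add: density_matrices_dagger trace_sub density_matrices_trace det_2)
    obtain a x y where \<sigma>1: "\<sigma>1 = herm a (1 - a) x y"
      using \<sigma>(1) by (rule density_matrices_2E)
    obtain a' x' y' where \<sigma>2: "\<sigma>2 = herm a' (1 - a') x' y'"
      using \<sigma>(2) by (rule density_matrices_2E)
    \<comment> \<open>A quarter of the squared distance of the Bloch vectors.\<close>
    have "- Re (det (\<sigma>1 - \<sigma>2)) = (a - a')\<^sup>2 + (x - x')\<^sup>2 + (y - y')\<^sup>2"
      unfolding \<sigma>1 \<sigma>2 herm_diff det_herm by (simp add: algebra_simps power2_eq_square)
    with det have "(a - a')\<^sup>2 + (x - x')\<^sup>2 + (y - y')\<^sup>2 \<le> 0" by simp
    then have "(a - a')\<^sup>2 = 0" "(x - x')\<^sup>2 = 0" "(y - y')\<^sup>2 = 0"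
      by (smt (verit) zero_le_power2)+
    then have "\<sigma>1 = \<sigma>2" by (simp add: \<sigma>1 \<sigma>2)
    show ?thesis
    \<comment> \<open>Both pure states are sent to \<open>\<sigma>1\<close>. The premise holds
      because a real multiple of a state has the least trace norm among Hermitian operators of its
      trace.\<close>
    proof (rule channel_from_pure_pair[OF f c \<sigma>(1) \<sigma>(1)])
      fix \<alpha> \<beta> :: real assume \<alpha>\<beta>: "0 \<le> \<alpha>" "0 \<le> \<beta>"
      have "det ((\<alpha> - \<beta>) *\<^sub>R \<sigma>1) = of_real ((\<alpha> - \<beta>)\<^sup>2) * det \<sigma>1"
        unfolding det_2 vector_scaleR_component
        by (simp add: scaleR_conv_of_real power2_eq_square algebra_simps)
      moreover have "0 \<le> Re (det \<sigma>1)"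
        using \<sigma> by (simp add: density_matrices_def positive_op_2)
      ultimately have "0 \<le> Re (det ((\<alpha> - \<beta>) *\<^sub>R \<sigma>1))"
        by simp
      then have "trace_norm ((\<alpha> - \<beta>) *\<^sub>R \<sigma>1) \<le> trace_norm (\<alpha> *\<^sub>R outer f - \<beta> *\<^sub>R outer g)"
        using \<sigma> f by (subst trace_norm_le_iff)
          (simp_all add: density_matrices_dagger trace_sub trace_scaleR trace_outer density_matrices_trace)
      then show "trace_norm (\<alpha> *\<^sub>R \<sigma>1 - \<beta> *\<^sub>R \<sigma>1) \<le> trace_norm (\<alpha> *\<^sub>R outer f - \<beta> *\<^sub>R outer g)"
        by (simp add: scaleR_left_diff_distrib)
    next
      fix T assume T: "cptp T" "T (outer f) = \<sigma>1" "T (outer g) = \<sigma>1"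
      then have "T \<rho>1 = \<sigma>1" "T \<rho>2 = \<sigma>1"
        by (simp_all add: \<rho>_eq cptp_linear flip: scaleR_left_distrib)
      with T(1) \<open>\<sigma>1 = \<sigma>2\<close> that show ?thesis by simp
    qed
  qed
qed

section \<open>Markovianity\<close>

lemma trace_norm_nonneg:
  fixes A :: "2 operator"
  assumes "dagger A = A"
  shows "0 \<le> trace_norm A"
  using hermitian_2E[OF assms] by (metis max.coboundedI1 real_sqrt_ge_zero trace_norm_herm zero_le_power2)

lemma trace_norm_scaleR:
  fixes A :: "2 operator"
  assumes "dagger A = A" "0 \<le> r"
  shows "trace_norm (r *\<^sub>R A) = r * trace_norm A"
proof -
  obtain a e x y where A: "A = herm a e x y" using assms(1) by (rule hermitian_2E)
  have "max ((r * a + r * e)\<^sup>2) ((r * a - r * e)\<^sup>2 + 4 * (r * x)\<^sup>2 + 4 * (r * y)\<^sup>2)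
      = r\<^sup>2 * max ((a + e)\<^sup>2) ((a - e)\<^sup>2 + 4 * x\<^sup>2 + 4 * y\<^sup>2)"
    by (simp add: max_mult_distrib_left power_mult_distrib algebra_simps power2_eq_square)
  then show ?thesis
    using assms(2) by (simp add: A trace_norm_herm real_sqrt_mult)
qed

lemma GTD_eq_0: "length E \<noteq> 2 \<Longrightarrow> GTD E = 0"
  by (cases E rule: GTD.cases) auto

lemma map_ensemble_size:
  assumes "cptp T" "E \<in> ensembles_of_size n"
  shows "map_ensemble T E \<in> ensembles_of_size n"
proof -
  have "map fst (map_ensemble T E) = map fst E"
    by (simp add: map_ensemble_def case_prod_beta comp_def)
  then show ?thesis
    using assms by (auto simp: ensembles_of_size_def) (auto simp: map_ensemble_def cptp_density)
qed

lemma GTD_bounds: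
  fixes E :: "2 ensemble"
  assumes "E \<in> ensembles_of_size n"
  shows "0 \<le> GTD E" "GTD E \<le> 1"
proof -
  have "0 \<le> GTD E \<and> GTD E \<le> 1"
  proof (cases "n = 2")
    case True
    then obtain p \<rho> q \<sigma> where E: "E = [(p, \<rho>), (q, \<sigma>)]" "0 \<le> p" "0 \<le> q" "p + q = 1"
      "\<rho> \<in> density_matrices" "\<sigma> \<in> density_matrices"
      using assms by (auto elim: ensembles_of_size_2E)
    have "trace_norm (p *\<^sub>R \<rho> - q *\<^sub>R \<sigma>) \<le> Re (trace (p *\<^sub>R \<rho>)) + Re (trace (q *\<^sub>R \<sigma>))"
      using E by (intro trace_norm_diff_le positive_op_scaleR) (auto simp: density_matrices_def)
    also have "\<dots> = 1" using E by (simp add: trace_scaleR density_matrices_trace)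
    finally show ?thesis
      using E by (simp add: trace_norm_nonneg density_matrices_dagger)
  next
    case False
    then show ?thesis using assms by (simp add: GTD_eq_0 ensembles_of_size_def)
  qed
  then show "0 \<le> GTD E" "GTD E \<le> 1" by simp_all
qed

lemma system_PQ_GTD: "system_PQ_of_size 2 (GTD :: 2 ensemble \<Rightarrow> real)"
proof -
  have "bounded (GTD ` (ensembles :: 2 ensemble set))"
    unfolding bounded_iff ensembles_def using GTD_bounds by (intro exI[of _ 1]) auto
  moreover have "GTD (map_ensemble T E) \<le> GTD E" if "cptp T" "E \<in> ensembles" for T and E :: "2 ensemble"
  proof (cases "E \<in> ensembles_of_size 2")
    case True
    then obtain p \<rho> q \<sigma> where E: "E = [(p, \<rho>), (q, \<sigma>)]"
      "\<rho> \<in> density_matrices" "\<sigma> \<in> density_matrices"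
      by (rule ensembles_of_size_2E)
    have "trace_norm (T (p *\<^sub>R \<rho> - q *\<^sub>R \<sigma>)) \<le> trace_norm (p *\<^sub>R \<rho> - q *\<^sub>R \<sigma>)"
      using E that by (intro cptp_trace_norm_le) (simp_all add: density_matrices_dagger)
    then show ?thesis using that by (simp add: E map_ensemble_def cptp_linear)
  next
    case False
    then have "length E \<noteq> 2" using that(2) by (auto simp: ensembles_def ensembles_of_size_def)
    then show ?thesis by (simp add: GTD_eq_0 map_ensemble_def)
  qed
  moreover have "GTD E = 0" if "E \<in> ensembles - ensembles_of_size 2" for E :: "2 ensemble"
    using that by (intro GTD_eq_0) (auto simp: ensembles_def ensembles_of_size_def)
  ultimately show ?thesis
    unfolding system_PQ_of_size_def system_PQ_def
    using GTD_bounds by (auto simp: ensembles_def)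
qed

theorem theorem3:
  fixes \<Lambda> :: "real \<Rightarrow> 2 operator \<Rightarrow> 2 operator"
  assumes "dynamical_map \<Lambda>"
  shows "GTD_Markovian \<Lambda> \<longleftrightarrow> S_Markovian 2 \<Lambda>"
proof
  assume S: "S_Markovian 2 \<Lambda>"
  show "GTD_Markovian \<Lambda>"
    unfolding GTD_Markovian_def
  proof
    fix E :: "2 ensemble" assume "E \<in> ensembles"
    show "antimono_on {0..} (\<lambda>t. dynamic_PQ \<Lambda> GTD t E)"
    proof (cases "E \<in> ensembles_of_size 2")
      case True
      with S system_PQ_GTD show ?thesis unfolding S_Markovian_def by blast
    next
      case False
      \<comment> \<open>On other sizes the quantifier is constantly zero in time.\<close>
      then have "length E \<noteq> 2"
        using \<open>E \<in> ensembles\<close> by (auto simp: ensembles_def ensembles_of_size_def)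
      then show ?thesis
        by (simp add: dynamic_PQ_def GTD_eq_0 map_ensemble_def monotone_on_def)
    qed
  qed
next
  assume G: "GTD_Markovian \<Lambda>"
  show "S_Markovian 2 \<Lambda>"
    unfolding S_Markovian_def
  proof (intro allI impI ballI)
    fix I :: "2 ensemble \<Rightarrow> real" and E :: "2 ensemble"
    assume I: "system_PQ_of_size 2 I" and E2: "E \<in> ensembles_of_size 2"
    show "antimono_on {0..} (\<lambda>t. dynamic_PQ \<Lambda> I t E)"
    proof (rule monotone_onI)
      fix s t :: real assume st: "s \<in> {0..}" "t \<in> {0..}" "s \<le> t"
      with assms have cptp: "cptp (\<Lambda> s)" "cptp (\<Lambda> t)" by (auto simp: dynamical_map_def)
      obtain p \<rho> q \<sigma> where E: "E = [(p, \<rho>), (q, \<sigma>)]"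
        and dens: "\<rho> \<in> density_matrices" "\<sigma> \<in> density_matrices"
        using E2 by (rule ensembles_of_size_2E)
      note states = cptp_density[OF cptp(1) dens(1)] cptp_density[OF cptp(1) dens(2)]
        cptp_density[OF cptp(2) dens(1)] cptp_density[OF cptp(2) dens(2)]
      note hermitian = states[THEN density_matrices_dagger]
      have "trace_norm (\<alpha> *\<^sub>R \<Lambda> t \<rho> - \<beta> *\<^sub>R \<Lambda> t \<sigma>) \<le> trace_norm (\<alpha> *\<^sub>R \<Lambda> s \<rho> - \<beta> *\<^sub>R \<Lambda> s \<sigma>)"
        if "0 \<le> \<alpha>" "0 \<le> \<beta>" for \<alpha> \<beta>
      proof (cases "\<alpha> + \<beta> = 0")
        case True
        with that show ?thesis by (simp add: add_nonneg_eq_0_iff)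
      next
        case False
        with that have pos: "0 < \<alpha> + \<beta>" by simp
        \<comment> \<open>GTD-Markovianity covers only weights of sum 1; homogeneity of the trace
          norm extends it to all nonnegative ones.\<close>
        define p' q' where "p' = \<alpha> / (\<alpha> + \<beta>)" "q' = \<beta> / (\<alpha> + \<beta>)"
        then have pq: "0 \<le> p'" "0 \<le> q'" "p' + q' = 1" "(\<alpha> + \<beta>) * p' = \<alpha>" "(\<alpha> + \<beta>) * q' = \<beta>"
          using pos that by (simp_all flip: add_divide_distrib)
        then have "[(p', \<rho>), (q', \<sigma>)] \<in> ensembles"
          using dens ensembles_of_size_2I by (fastforce simp: ensembles_def)
        then have "dynamic_PQ \<Lambda> GTD t [(p', \<rho>), (q', \<sigma>)] \<le> dynamic_PQ \<Lambda> GTD s [(p', \<rho>), (q', \<sigma>)]"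
          using G st unfolding GTD_Markovian_def by (auto simp: monotone_on_def)
        then have le: "trace_norm (p' *\<^sub>R \<Lambda> t \<rho> - q' *\<^sub>R \<Lambda> t \<sigma>)
            \<le> trace_norm (p' *\<^sub>R \<Lambda> s \<rho> - q' *\<^sub>R \<Lambda> s \<sigma>)"
          by (simp add: dynamic_PQ_def map_ensemble_def)
        have scale: "trace_norm (\<alpha> *\<^sub>R A - \<beta> *\<^sub>R B) = (\<alpha> + \<beta>) * trace_norm (p' *\<^sub>R A - q' *\<^sub>R B)"
          if "dagger A = A" "dagger B = B" for A B :: "2 operator"
        proof -
          have "(\<alpha> + \<beta>) *\<^sub>R (p' *\<^sub>R A - q' *\<^sub>R B) = \<alpha> *\<^sub>R A - \<beta> *\<^sub>R B"
            by (simp only: scaleR_diff_right scaleR_scaleR pq)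
          moreover have "dagger (p' *\<^sub>R A - q' *\<^sub>R B) = p' *\<^sub>R A - q' *\<^sub>R B"
            using that by simp
          ultimately show ?thesis using trace_norm_scaleR pos by (metis less_imp_le)
        qed
        show ?thesis
          unfolding scale[OF hermitian(1,2)] scale[OF hermitian(3,4)]
          using le pos by (intro mult_left_mono) auto
      qed
      \<comment> \<open>One channel carries both states from time \<open>s\<close> to time
        \<open>t\<close>. It may depend on the pair, which is enough for the monotonicity of
        \<open>I\<close> under channels.\<close>
      then obtain T where T: "cptp T" "T (\<Lambda> s \<rho>) = \<Lambda> t \<rho>" "T (\<Lambda> s \<sigma>) = \<Lambda> t \<sigma>"
        using alberti_uhlmann[OF states]
        by metis
      have "map_ensemble (\<Lambda> s) E \<in> ensembles"
        using map_ensemble_size[OF cptp(1) E2] by (force simp: ensembles_def)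
      then have "I (map_ensemble T (map_ensemble (\<Lambda> s) E)) \<le> I (map_ensemble (\<Lambda> s) E)"
        using I T(1) by (simp add: system_PQ_of_size_def system_PQ_def)
      then show "dynamic_PQ \<Lambda> I t E \<le> dynamic_PQ \<Lambda> I s E"
        by (simp add: dynamic_PQ_def E map_ensemble_def T)
    qed
  qed
qed

end
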